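(* Let $B$ be a paracompact Hausdorff space, $\mathcal{U}=\{U_r\}$ an open cover of $B$, and $\{\varphi_t\}$ a continuous partition of unity dominated by $\mathcal{U}$. If each $U_r\cap U_t$ is either empty or connected, then $$\Delta^{-1}\circ\Psi_{\mathcal{U}}:H^2(\mathcal{N}(\mathcal{U});\mathbb{Z})\longrightarrow\check{H}^1(\mathcal{U};\mathfrak{Im}(\exp)),\qquad[\{\eta_{rst}\}]\mapsto[\{\omega_{rs}\}],$$ is injective, where $\omega_{rs}=\exp\Big(2\pi i\sum_t\varphi_t\cdot\eta_{rst}\Big)$.
   Context: A partition of unity dominated by $\mathcal{U}=\{U_r\}$ is a collection of continuous maps $\varphi_r:U_r\to\mathbb{R}_{\ge0}$ such that $\sum_r\varphi_r=1$ and $\mathsf{support}(\varphi_r)\subset\mathsf{closure}(U_r)$; in sums, $\varphi_r(b)$ is read as $0$ for $b\notin U_r$. The nerve $\mathcal{N}(\mathcal{U})$ is the abstract simplicial complex with one vertex $r$ for each $U_r\in\mathcal{U}$ and a simplex $\{r_0,\ldots,r_k\}$ for each collection with $U_{r_0}\cap\cdots\cap U_{r_k}\neq\emptyset$. $C^k(\mathcal{N}(\mathcal{U});\mathbb{Z})$ is the group of integer-valued functions on $k$-simplices which are zero on all but finitely many $k$-simplices, with the usual simplicial coboundary $\delta^k(\phi)(\{s_0,\ldots,s_{k+1}\})=\sum_j(-1)^j\phi(\{s_0,\ldots,s_{k+1}\}\smallsetminus\{s_j\})$; $Z^k$, $H^k$ are cocycles and cohomology. For a $2$-cochain $\eta$,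 $\eta_{rst}$ denotes its value on $\{r,s,t\}$, extended to all ordered triples as an alternating function. For a presheaf $\mathcal{F}$ of abelian groups on $B$, $\check{C}^n(\mathcal{U};\mathcal{F})=\prod_{(j_0,\ldots,j_n)}\mathcal{F}(U_{j_0}\cap\cdots\cap U_{j_n})$, with coboundary the alternating sum $\sum_r(-1)^r$ of the restrictions of $f_{k_0,\ldots,\widehat{k_r},\ldots,k_{n+1}}$, and cohomology $\check{H}^n(\mathcal{U};\mathcal{F})$. $\underline{\mathbb{Z}}$ is the sheaf of locally constant $\mathbb{Z}$-valued functions, and $\mathscr{C}_{\mathbb{C}}$, $\mathscr{C}_{\mathbb{C}}^\times$ are the sheaves of continuous $\mathbb{C}$-valued and $\mathbb{C}^\times$-valued functions. The morphism $\exp:\mathscr{C}_{\mathbb{C}}\to\mathscr{C}_{\mathbb{C}}^\times$ is $f\mapsto e^{2\pi if}$, and $\mathfrak{Im}(\exp)$ is its image presheaf, $U\mapsto\exp(\mathscr{C}_{\mathbb{C}}(U))$. $\Delta:\check{H}^1(\mathcal{U};\mathfrak{Im}(\exp))\to\check{H}^2(\mathcal{U};\underline{\mathbb{Z}})$ is the connecting homomorphism of the short exact sequence of presheaves $0\to\underline{\mathbb{Z}}\to\mathscr{C}_{\mathbb{C}}\to\mathfrak{Im}(\exp)\to0$; it is an isomorphism because $\check{H}^k(\mathcal{U};\mathscr{C}_{\mathbb{C}})=0$ for $k\ge1$. $\Psi_{\mathcal{U}}:H^2(\mathcal{N}(\mathcal{U});\mathbb{Z})\to\check{H}^2(\mathcal{U};\underline{\mathbb{Z}})$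 sends $[\sigma]$ to the class of the cocycle of constant functions $\sigma_{rst}$ on $U_r\cap U_s\cap U_t$.
   Formalization: H² of the nerve uses all integer cochains, not only finitely supported ones, for which injectivity fails (vertex stars of a triangulated plane); the ω formula is claimed for finitely supported η, and for other η only if the partition of unity is locally finite. *)

theory Defs
  imports "HOL-Analysis.Analysis" "HOL-Algebra.FiniteProduct" "HOL-Algebra.Product_Groups"
begin

definition paracompact_space :: "'a topology \<Rightarrow> bool" where
  "paracompact_space X \<longleftrightarrow>
     (\<forall>\<A>. (\<forall>A\<in>\<A>. openin X A) \<and> \<Union>\<A> = topspace X \<longrightarrow>
        (\<exists>\<B>. (\<forall>B\<in>\<B>. openin X B) \<and> \<Union>\<B> = topspace X \<and>
             (\<forall>B\<in>\<B>. \<exists>A\<in>\<A>. B \<subseteq> A) \<and> locally_finite_in X \<B>))"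

definition open_cover :: "'a topology \<Rightarrow> 'i set \<Rightarrow> ('i \<Rightarrow> 'a set) \<Rightarrow> bool" where
  "open_cover X I U \<longleftrightarrow> (\<forall>r\<in>I. openin X (U r)) \<and> (\<Union>r\<in>I. U r) = topspace X"

definition zero_ext :: "('i \<Rightarrow> 'a set) \<Rightarrow> ('i \<Rightarrow> 'a \<Rightarrow> real) \<Rightarrow> 'i \<Rightarrow> 'a \<Rightarrow> real" where
  "zero_ext U \<phi> r b = (if b \<in> U r then \<phi> r b else 0)"

text \<open>
  Only the values of \<open>\<phi> r\<close> on \<open>U r\<close> matter, and the sum is an unconditional pointwise sum. The
  family is not required to be locally finite.
\<close>
definition dominated_partition_of_unity ::
    "'a topology \<Rightarrow> 'i set \<Rightarrow> ('i \<Rightarrow> 'a set) \<Rightarrow> ('i \<Rightarrow> 'a \<Rightarrow> real) \<Rightarrow> bool" where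
  "dominated_partition_of_unity X I U \<phi> \<longleftrightarrow>
     (\<forall>r\<in>I. continuous_map (subtopology X (U r)) euclideanreal (\<phi> r) \<and>
            (\<forall>b\<in>U r. 0 \<le> \<phi> r b) \<and>
            X closure_of {b \<in> U r. \<phi> r b \<noteq> 0} \<subseteq> X closure_of U r) \<and>
     (\<forall>b\<in>topspace X. ((\<lambda>r. zero_ext U \<phi> r b) has_sum 1) I)"

definition locally_finite_partition ::
    "'a topology \<Rightarrow> 'i set \<Rightarrow> ('i \<Rightarrow> 'a set) \<Rightarrow> ('i \<Rightarrow> 'a \<Rightarrow> real) \<Rightarrow> bool" where
  "locally_finite_partition X I U \<phi> \<longleftrightarrow>
     (\<forall>b\<in>topspace X. \<exists>V. openin X V \<and> b \<in> V \<and> finite {t \<in> I. \<exists>x\<in>V. zero_ext U \<phi> t x \<noteq> 0})"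

fun coboundaries :: "(nat \<Rightarrow> 'g monoid) \<Rightarrow> (nat \<Rightarrow> 'g \<Rightarrow> 'g) \<Rightarrow> nat \<Rightarrow> 'g set" where
  "coboundaries C d 0 = {\<one>\<^bsub>C 0\<^esub>}"
| "coboundaries C d (Suc n) = d n ` carrier (C n)"

definition cocycles :: "(nat \<Rightarrow> 'g monoid) \<Rightarrow> (nat \<Rightarrow> 'g \<Rightarrow> 'g) \<Rightarrow> nat \<Rightarrow> 'g set" where
  "cocycles C d n = kernel (C n) (C (Suc n)) (d n)"

definition cohomology :: "(nat \<Rightarrow> 'g monoid) \<Rightarrow> (nat \<Rightarrow> 'g \<Rightarrow> 'g) \<Rightarrow> nat \<Rightarrow> 'g set monoid" where
  "cohomology C d n = (C n)\<lparr>carrier := cocycles C d n\<rparr> Mod coboundaries C d n"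

definition coho_class :: "(nat \<Rightarrow> 'g monoid) \<Rightarrow> (nat \<Rightarrow> 'g \<Rightarrow> 'g) \<Rightarrow> nat \<Rightarrow> 'g \<Rightarrow> 'g set" where
  "coho_class C d n c = coboundaries C d n #>\<^bsub>C n\<^esub> c"

definition nerve_simplices :: "'i set \<Rightarrow> ('i \<Rightarrow> 'a set) \<Rightarrow> nat \<Rightarrow> 'i set set" where
  "nerve_simplices I U k =
     {S. S \<subseteq> I \<and> finite S \<and> card S = Suc k \<and> (\<Inter>r\<in>S. U r) \<noteq> {}}"

definition nerve_cochains :: "'i set \<Rightarrow> ('i \<Rightarrow> 'a set) \<Rightarrow> nat \<Rightarrow> ('i set \<Rightarrow> int) monoid" where
  "nerve_cochains I U k = product_group (nerve_simplices I U k) (\<lambda>_. integer_group)"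

text \<open>The signs refer to the vertices of a simplex listed in increasing order.\<close>
definition nerve_coboundary ::
    "'i::linorder set \<Rightarrow> ('i \<Rightarrow> 'a set) \<Rightarrow> nat \<Rightarrow> ('i set \<Rightarrow> int) \<Rightarrow> 'i set \<Rightarrow> int" where
  "nerve_coboundary I U k \<phi> =
     (\<lambda>S\<in>nerve_simplices I U (Suc k).
        \<Sum>j\<le>Suc k. (- 1) ^ j * \<phi> (S - {sorted_list_of_set S ! j}))"

abbreviation nerve_cohomology ::
    "'i::linorder set \<Rightarrow> ('i \<Rightarrow> 'a set) \<Rightarrow> nat \<Rightarrow> ('i set \<Rightarrow> int) set monoid" where
  "nerve_cohomology I U \<equiv> cohomology (nerve_cochains I U) (nerve_coboundary I U)"

text \<open>
  The group of finitely supported cochains. The coboundary preserves finite support only if each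
  simplex has finitely many cofaces, and even then these cochains compute cohomology with compact
  supports. The cohomology of the nerve is therefore taken with all cochains; the two agree for a
  finite cover.
\<close>
definition nerve_cochains_fs :: "'i set \<Rightarrow> ('i \<Rightarrow> 'a set) \<Rightarrow> nat \<Rightarrow> ('i set \<Rightarrow> int) monoid" where
  "nerve_cochains_fs I U k = sum_group (nerve_simplices I U k) (\<lambda>_. integer_group)"

lemma nerve_cochains_fs_eq:
  assumes "finite I"
  shows "nerve_cochains_fs I U = nerve_cochains I U"
proof
  fix k
  have "nerve_simplices I U k \<subseteq> Pow I"
    by (auto simp: nerve_simplices_def)
  then have fin: "finite (nerve_simplices I U k)"
    using assms by (meson finite_Pow_iff finite_subset)
  let ?S = "nerve_simplices I U k" and ?Z = "\<lambda>_::'a set. integer_group"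
  have "{x \<in> \<Pi>\<^sub>E i\<in>?S. carrier (?Z i). finite {i \<in> ?S. x i \<noteq> \<one>\<^bsub>?Z i\<^esub>}} = carrier (product_group ?S ?Z)"
    using fin by auto
  then have "sum_group ?S ?Z = subgroup_generated (product_group ?S ?Z) (carrier (product_group ?S ?Z))"
    by (simp add: sum_group_def)
  also have "\<dots> = product_group ?S ?Z"
    by (rule group.subgroup_generated_group_carrier) simp
  finally show "nerve_cochains_fs I U k = nerve_cochains I U k"
    by (simp add: nerve_cochains_fs_def nerve_cochains_def)
qed

text \<open>
  For \<open>js = [r, s, t]\<close> this is the value of the alternating extension on the ordered triple
  \<open>(r, s, t)\<close>; the exponent is the number of inversions of \<open>js\<close>.
\<close>
definition alt_ext ::
    "'i::linorder set \<Rightarrow> ('i \<Rightarrow> 'a set) \<Rightarrow> nat \<Rightarrow> ('i set \<Rightarrow> int) \<Rightarrow> 'i list \<Rightarrow> int" where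
  "alt_ext I U k \<eta> js =
     (if distinct js \<and> set js \<in> nerve_simplices I U k
      then (- 1) ^ card {(a, b). a < b \<and> b < length js \<and> js ! b < js ! a} * \<eta> (set js)
      else 0)"

text \<open>\<open>res F V W\<close> is the restriction map from \<open>sections F V\<close> to \<open>sections F W\<close> for \<open>W \<subseteq> V\<close>.\<close>
record ('a, 'g) presheaf =
  sections :: "'a set \<Rightarrow> 'g monoid"
  res :: "'a set \<Rightarrow> 'a set \<Rightarrow> 'g \<Rightarrow> 'g"

definition tuples :: "'i set \<Rightarrow> nat \<Rightarrow> 'i list set" where
  "tuples I n = {js. length js = Suc n \<and> set js \<subseteq> I}"

definition overlap :: "('i \<Rightarrow> 'a set) \<Rightarrow> 'i list \<Rightarrow> 'a set" where
  "overlap U js = (\<Inter>j\<in>set js. U j)"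

definition omit :: "nat \<Rightarrow> 'i list \<Rightarrow> 'i list" where
  "omit r ks = take r ks @ drop (Suc r) ks"

definition cech_cochains ::
    "'i set \<Rightarrow> ('i \<Rightarrow> 'a set) \<Rightarrow> ('a, 'g) presheaf \<Rightarrow> nat \<Rightarrow> ('i list \<Rightarrow> 'g) monoid" where
  "cech_cochains I U F n = product_group (tuples I n) (\<lambda>js. sections F (overlap U js))"

definition cech_coboundary ::
    "'i set \<Rightarrow> ('i \<Rightarrow> 'a set) \<Rightarrow> ('a, 'g) presheaf \<Rightarrow> nat \<Rightarrow> ('i list \<Rightarrow> 'g) \<Rightarrow> 'i list \<Rightarrow> 'g" where
  "cech_coboundary I U F n f =
     (\<lambda>ks\<in>tuples I (Suc n).
        finprod (sections F (overlap U ks))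
          (\<lambda>r. res F (overlap U (omit r ks)) (overlap U ks) (f (omit r ks))
                 [^]\<^bsub>sections F (overlap U ks)\<^esub> ((- 1) ^ r :: int))
          {..Suc n})"

abbreviation cech_cohomology ::
    "'i set \<Rightarrow> ('i \<Rightarrow> 'a set) \<Rightarrow> ('a, 'g) presheaf \<Rightarrow> nat \<Rightarrow> ('i list \<Rightarrow> 'g) set monoid" where
  "cech_cohomology I U F \<equiv> cohomology (cech_cochains I U F) (cech_coboundary I U F)"

abbreviation cech_class ::
    "'i set \<Rightarrow> ('i \<Rightarrow> 'a set) \<Rightarrow> ('a, 'g) presheaf \<Rightarrow> nat \<Rightarrow> ('i list \<Rightarrow> 'g) \<Rightarrow> ('i list \<Rightarrow> 'g) set" where
  "cech_class I U F \<equiv> coho_class (cech_cochains I U F) (cech_coboundary I U F)"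

definition cech_map ::
    "'i set \<Rightarrow> ('i \<Rightarrow> 'a set) \<Rightarrow> nat \<Rightarrow> ('a set \<Rightarrow> 'g \<Rightarrow> 'h) \<Rightarrow> ('i list \<Rightarrow> 'g) \<Rightarrow> 'i list \<Rightarrow> 'h" where
  "cech_map I U n m f = (\<lambda>js\<in>tuples I n. m (overlap U js) (f js))"

text \<open>
  The connecting map in degree \<open>n\<close> of a short exact sequence of presheaves
  \<open>0 \<rightarrow> F \<rightarrow> G \<rightarrow> H \<rightarrow> 0\<close> with maps \<open>i\<close> and \<open>p\<close>: lift a representing cocycle along \<open>p\<close>, apply the
  coboundary of \<open>G\<close>, and pull the result back along \<open>i\<close>. The set below is a singleton when the
  sequence is exact.
\<close>
definition connecting ::
    "'i set \<Rightarrow> ('i \<Rightarrow> 'a set) \<Rightarrow> ('a, 'g) presheaf \<Rightarrow> ('a, 'h) presheaf \<Rightarrow>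
     ('a set \<Rightarrow> 'g \<Rightarrow> 'h) \<Rightarrow> ('a set \<Rightarrow> 'h \<Rightarrow> 'k) \<Rightarrow> nat \<Rightarrow> ('i list \<Rightarrow> 'k) set \<Rightarrow> ('i list \<Rightarrow> 'g) set" where
  "connecting I U F G i p n c =
     the_elem {cech_class I U F (Suc n) a | a g.
        a \<in> carrier (cech_cochains I U F (Suc n)) \<and>
        g \<in> carrier (cech_cochains I U G n) \<and>
        cech_map I U n p g \<in> c \<and>
        cech_map I U (Suc n) i a = cech_coboundary I U G n g}"

text \<open>A function on \<open>V\<close> is represented by its extension with value \<open>undefined\<close> outside \<open>V\<close>.\<close>

definition const_Z :: "'a topology \<Rightarrow> ('a, 'a \<Rightarrow> int) presheaf" where
  "const_Z X =
     \<lparr>sections = \<lambda>V.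
        \<lparr>carrier = {f \<in> extensional V.
           \<forall>b\<in>V. \<exists>W. openin X W \<and> b \<in> W \<and> W \<subseteq> V \<and> (\<forall>x\<in>W. f x = f b)},
         mult = \<lambda>f g. \<lambda>x\<in>V. f x + g x,
         one = \<lambda>x\<in>V. 0\<rparr>,
      res = \<lambda>V W f. restrict f W\<rparr>"

definition cont_C :: "'a topology \<Rightarrow> ('a, 'a \<Rightarrow> complex) presheaf" where
  "cont_C X =
     \<lparr>sections = \<lambda>V.
        \<lparr>carrier = {f \<in> extensional V. continuous_map (subtopology X V) euclidean f},
         mult = \<lambda>f g. \<lambda>x\<in>V. f x + g x,
         one = \<lambda>x\<in>V. 0\<rparr>,
      res = \<lambda>V W f. restrict f W\<rparr>"

definition cont_C_units :: "'a topology \<Rightarrow> ('a, 'a \<Rightarrow> complex) presheaf" where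
  "cont_C_units X =
     \<lparr>sections = \<lambda>V.
        \<lparr>carrier = {f \<in> extensional V. continuous_map (subtopology X V) euclidean f \<and> (\<forall>x\<in>V. f x \<noteq> 0)},
         mult = \<lambda>f g. \<lambda>x\<in>V. f x * g x,
         one = \<lambda>x\<in>V. 1\<rparr>,
      res = \<lambda>V W f. restrict f W\<rparr>"

definition incl_Z :: "'a set \<Rightarrow> ('a \<Rightarrow> int) \<Rightarrow> 'a \<Rightarrow> complex" where
  "incl_Z V f = (\<lambda>x\<in>V. of_int (f x))"

definition exp_map :: "'a set \<Rightarrow> ('a \<Rightarrow> complex) \<Rightarrow> 'a \<Rightarrow> complex" where
  "exp_map V f = (\<lambda>x\<in>V. exp (2 * of_real pi * \<i> * f x))"

definition image_presheaf ::
    "('a set \<Rightarrow> 'g \<Rightarrow> 'h) \<Rightarrow> ('a, 'g) presheaf \<Rightarrow> ('a, 'h) presheaf \<Rightarrow> ('a, 'h) presheaf" where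
  "image_presheaf m F G =
     G\<lparr>sections := \<lambda>V. (sections G V)\<lparr>carrier := m V ` carrier (sections F V)\<rparr>\<rparr>"

definition Im_exp :: "'a topology \<Rightarrow> ('a, 'a \<Rightarrow> complex) presheaf" where
  "Im_exp X = image_presheaf exp_map (cont_C X) (cont_C_units X)"

definition Delta ::
    "'a topology \<Rightarrow> 'i set \<Rightarrow> ('i \<Rightarrow> 'a set) \<Rightarrow> ('i list \<Rightarrow> 'a \<Rightarrow> complex) set \<Rightarrow> ('i list \<Rightarrow> 'a \<Rightarrow> int) set" where
  "Delta X I U = connecting I U (const_Z X) (cont_C X) incl_Z exp_map 1"

definition Delta_inv ::
    "'a topology \<Rightarrow> 'i set \<Rightarrow> ('i \<Rightarrow> 'a set) \<Rightarrow> ('i list \<Rightarrow> 'a \<Rightarrow> int) set \<Rightarrow> ('i list \<Rightarrow> 'a \<Rightarrow> complex) set" where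
  "Delta_inv X I U = inv_into (carrier (cech_cohomology I U (Im_exp X) 1)) (Delta X I U)"

definition Psi ::
    "'a topology \<Rightarrow> 'i::linorder set \<Rightarrow> ('i \<Rightarrow> 'a set) \<Rightarrow> ('i set \<Rightarrow> int) set \<Rightarrow> ('i list \<Rightarrow> 'a \<Rightarrow> int) set" where
  "Psi X I U c =
     the_elem ((\<lambda>\<sigma>. cech_class I U (const_Z X) 2
                  (\<lambda>js\<in>tuples I 2. \<lambda>b\<in>overlap U js. alt_ext I U 2 \<sigma> js)) ` c)"

definition omega ::
    "'i::linorder set \<Rightarrow> ('i \<Rightarrow> 'a set) \<Rightarrow> ('i \<Rightarrow> 'a \<Rightarrow> real) \<Rightarrow> ('i set \<Rightarrow> int) \<Rightarrow> 'i list \<Rightarrow> 'a \<Rightarrow> complex" where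
  "omega I U \<phi> \<eta> =
     (\<lambda>js\<in>tuples I 1. \<lambda>b\<in>overlap U js.
        exp (2 * of_real pi * \<i> *
             of_real (\<Sum>\<^sub>\<infinity>t\<in>I. zero_ext U \<phi> t b * of_int (alt_ext I U 2 \<eta> (js @ [t])))))"

end

theory Submission
  imports Defs
begin

text \<open>
  Extended by zero, each \<open>\<phi>\<^sub>t\<close> is continuous on all of \<open>X\<close>: near a boundary point of \<open>U t\<close> finitely
  many of the other functions already sum to almost \<open>1\<close>. After truncation the \<open>\<phi>\<^sub>t\<close> give a locally
  finite partition of unity with supports inside the \<open>U t\<close>, so the Cech complex of continuous complex
  functions is contractible in positive degrees and \<open>\<Delta>\<close> is an isomorphism. \<open>\<Psi>\<close> is injective because an integer
  valued Cech \<open>1\<close>-cochain is constant on each connected \<open>U r \<inter> U s\<close>, hence a \<open>1\<close>-cochain of the nerve.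
  Finally \<open>g\<^sub>r\<^sub>s = \<Sum>t. \<phi>\<^sub>t \<eta>\<^sub>r\<^sub>s\<^sub>t\<close> is a continuous cochain with coboundary \<open>\<eta>\<close> and exponential \<open>\<omega>\<close>, so
  \<open>\<Delta>[\<omega>] = \<Psi>[\<eta>]\<close>.
\<close>

section \<open>Partitions of unity\<close>

text \<open>A dominated function may be nonzero arbitrarily close to the boundary of its set, and
  infinitely many may be nonzero near one point. A contracting homotopy tolerates neither: it
  multiplies the function of index \<open>t\<close> by a section that exists only on
  \<open>U t\<close> and may be unbounded at the boundary, and it sums over all \<open>t\<close>.
  Hence a second partition is built for acyclicity alone, while \<open>omega\<close> keeps the given
  one, whose functions meet only integer constants there. These integers may still be unbounded in
  \<open>t\<close>, and then \<Sum> \<phi>_t \<eta>_rst need not converge. The formula for the class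
  of \<open>omega\<close> is therefore tied to finite support of the cochain or local finiteness of
  the partition, either of which makes the sum locally finite; injectivity concerns all classes. The
  third term of the exponential sequence is the image presheaf, so lifts exist on every open set and
  can be chosen tuple by tuple. Identities of cochains are checked at one point at a time, where
  they turn into identities of alternating sums over the faces of a list.\<close>

lemma continuous_map_openin_subtopology:
  fixes f :: "'a \<Rightarrow> 'b::topological_space"
  assumes "openin X V"
  shows "continuous_map (subtopology X V) euclidean f \<longleftrightarrow> (\<forall>b\<in>V. (f \<longlongrightarrow> f b) (nhdsin X b))"
proof -
  have V: "V \<subseteq> topspace X"
    using assms by (rule openin_subset)
  have "limitin euclidean f (f b) (atin (subtopology X V) b) \<longleftrightarrow> (f \<longlongrightarrow> f b) (nhdsin X b)"
    if b: "b \<in> V" for b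
  proof -
    \<comment> \<open>\<open>atin\<close> omits the point and \<open>nhdsin\<close> includes it;
      they agree on predicates that hold at \<open>b\<close>, such as membership of the value in a
      neighbourhood of \<open>f b\<close>. The filter \<open>nhdsin X b\<close> does not mention
      \<open>V\<close>, so restriction to smaller open sets costs nothing.\<close>
    have "eventually P (atin (subtopology X V) b) \<longleftrightarrow> eventually P (nhdsin X b)" if "P b" for P
    proof -
      have "(\<exists>T. openin X T \<and> b \<in> T \<and> (\<forall>x\<in>T. x \<in> V \<and> x \<noteq> b \<longrightarrow> P x)) \<longleftrightarrow>
            (\<exists>T. openin X T \<and> b \<in> T \<and> (\<forall>x\<in>T. P x))" (is "?L \<longleftrightarrow> ?R")
      proof
        assume ?L
        then obtain T where "openin X T" "b \<in> T" "\<forall>x\<in>T. x \<in> V \<and> x \<noteq> b \<longrightarrow> P x" by blast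
        then show ?R
          using assms b \<open>P b\<close> by (intro exI[of _ "T \<inter> V"]) auto
      qed blast
      then show ?thesis
        using b V by (auto simp: atin_subtopology_within eventually_atin_within eventually_nhdsin)
    qed
    then show ?thesis
      by (simp add: tendsto_def)
  qed
  then show ?thesis
    using V by (auto simp: continuous_map_atin topspace_subtopology Int_absorb1)
qed

lemma eventually_in_openin: "openin X V \<Longrightarrow> b \<in> V \<Longrightarrow> eventually (\<lambda>x. x \<in> V) (nhdsin X b)"
  by (auto simp: eventually_nhdsin)

lemma eventually_nhdsin_self: "eventually P (nhdsin X b) \<Longrightarrow> b \<in> topspace X \<Longrightarrow> P b"
  by (auto simp: eventually_nhdsin)

lemma eventually_in_topspace: "b \<in> topspace X \<Longrightarrow> eventually (\<lambda>x. x \<in> topspace X) (nhdsin X b)"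
  by (auto intro: eventually_in_openin)

section \<open>Tail estimates and continuity for a dominated partition of unity\<close>

context
  fixes X :: "'a topology" and I :: "'i set" and U :: "'i \<Rightarrow> 'a set" and \<phi> :: "'i \<Rightarrow> 'a \<Rightarrow> real"
  assumes cover: "open_cover X I U" and part: "dominated_partition_of_unity X I U \<phi>"
begin

private abbreviation (input) "\<psi> \<equiv> zero_ext U \<phi>"

lemma zero_ext_nonneg: "t \<in> I \<Longrightarrow> 0 \<le> \<psi> t b"
  using part by (auto simp: dominated_partition_of_unity_def zero_ext_def)

lemma zero_ext_has_sum: "b \<in> topspace X \<Longrightarrow> ((\<lambda>t. \<psi> t b) has_sum 1) I"
  using part by (auto simp: dominated_partition_of_unity_def)

lemma sum_zero_ext_le_1: "b \<in> topspace X \<Longrightarrow> finite F \<Longrightarrow> F \<subseteq> I \<Longrightarrow> (\<Sum>t\<in>F. \<psi> t b) \<le> 1"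
  using finite_sum_le_has_sum[OF zero_ext_has_sum] zero_ext_nonneg by (metis Diff_iff)

lemma zero_ext_le_1: "b \<in> topspace X \<Longrightarrow> t \<in> I \<Longrightarrow> \<psi> t b \<le> 1"
  using sum_zero_ext_le_1[of b "{t}"] by simp

lemma zero_ext_tendsto_interior:
  assumes "t \<in> I" "b \<in> U t"
  shows "(\<psi> t \<longlongrightarrow> \<psi> t b) (nhdsin X b)"
proof -
  have op: "openin X (U t)"
    using cover assms by (auto simp: open_cover_def)
  have "continuous_map (subtopology X (U t)) euclideanreal (\<phi> t)"
    using part assms by (auto simp: dominated_partition_of_unity_def)
  then have "(\<phi> t \<longlongrightarrow> \<phi> t b) (nhdsin X b)"
    using continuous_map_openin_subtopology[OF op] assms by blast
  then have "(\<psi> t \<longlongrightarrow> \<phi> t b) (nhdsin X b)"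
    by (rule Lim_transform_eventually)
      (use eventually_in_openin[OF op assms(2)] in eventually_elim, simp add: zero_ext_def)
  then show ?thesis
    using assms by (simp add: zero_ext_def)
qed

text \<open>The total is 1 and the terms are nonnegative: finitely many terms whose sum exceeds 1 -
  e at \<open>b\<close> keep doing so nearby and leave less than e for all remaining indices
  together. One neighbourhood serves every \<open>G\<close>, which replaces local
  finiteness.\<close>

lemma uniform_tail:
  assumes b: "b \<in> topspace X" and e: "0 < (e::real)"
  obtains F where "finite F" "F \<subseteq> {t\<in>I. b \<in> U t}"
    "eventually (\<lambda>x. \<forall>G. finite G \<longrightarrow> G \<subseteq> I - F \<longrightarrow> (\<Sum>t\<in>G. \<psi> t x) < e) (nhdsin X b)"
proof -
  obtain F0 where F0: "finite F0" "F0 \<subseteq> I" "dist (\<Sum>t\<in>F0. \<psi> t b) 1 \<le> e/2"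
    using has_sum_finite_approximation[OF zero_ext_has_sum[OF b], of "e/2"] e by auto
  \<comment> \<open>Indices with \<open>b\<close> outside \<open>U t\<close> contribute 0 at
    \<open>b\<close>; without them continuity at \<open>b\<close> is known for every term that is
    left.\<close>
  define F where "F = {t\<in>F0. b \<in> U t}"
  have F: "finite F" "F \<subseteq> {t\<in>I. b \<in> U t}"
    using F0 by (auto simp: F_def)
  have "(\<Sum>t\<in>F. \<psi> t b) = (\<Sum>t\<in>F0. \<psi> t b)"
    using F0 by (intro sum.mono_neutral_left) (auto simp: F_def zero_ext_def)
  then have lt: "1 - e < (\<Sum>t\<in>F. \<psi> t b)"
    using F0(3) e unfolding dist_real_def by linarith
  have "((\<lambda>x. \<Sum>t\<in>F. \<psi> t x) \<longlongrightarrow> (\<Sum>t\<in>F. \<psi> t b)) (nhdsin X b)"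
    using F by (intro tendsto_sum zero_ext_tendsto_interior) auto
  from order_tendstoD(1)[OF this lt] eventually_in_topspace[OF b]
  have "eventually (\<lambda>x. \<forall>G. finite G \<longrightarrow> G \<subseteq> I - F \<longrightarrow> (\<Sum>t\<in>G. \<psi> t x) < e) (nhdsin X b)"
  proof eventually_elim
    case (elim x)
    show ?case
    proof (intro allI impI)
      fix G assume G: "finite G" "G \<subseteq> I - F"
      then have "(\<Sum>t\<in>F. \<psi> t x) + (\<Sum>t\<in>G. \<psi> t x) = (\<Sum>t\<in>F \<union> G. \<psi> t x)"
        using F by (intro sum.union_disjoint[symmetric]) auto
      also have "\<dots> \<le> 1"
        using elim G F by (intro sum_zero_ext_le_1) auto
      finally show "(\<Sum>t\<in>G. \<psi> t x) < e"
        using elim by simp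
    qed
  qed
  with F that show thesis by blast
qed

lemma zero_ext_tendsto:
  assumes t: "t \<in> I" and b: "b \<in> topspace X"
  shows "(\<psi> t \<longlongrightarrow> \<psi> t b) (nhdsin X b)"
proof (cases "b \<in> U t")
  case False
  have "eventually (\<lambda>x. dist (\<psi> t x) 0 < e) (nhdsin X b)" if "0 < e" for e
  proof -
    obtain F where "finite F" and F: "F \<subseteq> {t\<in>I. b \<in> U t}"
      "eventually (\<lambda>x. \<forall>G. finite G \<longrightarrow> G \<subseteq> I - F \<longrightarrow> (\<Sum>t\<in>G. \<psi> t x) < e) (nhdsin X b)"
      by (rule uniform_tail[OF b \<open>0 < e\<close>])
    from F(2) show ?thesis
    proof eventually_elim
      case (elim x)
      \<comment> \<open>All indices in \<open>F\<close> have \<open>b\<close> in \<open>U t\<close>,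
        so \<open>t\<close> belongs to the tail, and the bound for the singleton is a bound for the
        function itself.\<close>
      have "{t} \<subseteq> I - F"
        using F t False by blast
      with elim have "(\<Sum>t\<in>{t}. \<psi> t x) < e"
        by blast
      then show ?case
        using zero_ext_nonneg[OF t, of x] by simp
    qed
  qed
  then have "(\<psi> t \<longlongrightarrow> 0) (nhdsin X b)"
    by (rule tendstoI)
  then show ?thesis
    using False by (simp add: zero_ext_def)
qed (use assms zero_ext_tendsto_interior in blast)

lemma summable_zero_ext_power2: "b \<in> topspace X \<Longrightarrow> (\<lambda>t. (\<psi> t b)\<^sup>2) summable_on I"
proof (rule summable_on_comparison_test)
  assume b: "b \<in> topspace X"
  show "(\<lambda>t. \<psi> t b) summable_on I"
    using zero_ext_has_sum[OF b] by (auto simp: summable_on_def)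
  show "(\<psi> t b)\<^sup>2 \<le> \<psi> t b" if "t \<in> I" for t
    using zero_ext_nonneg[OF that, of b] zero_ext_le_1[OF b that]
    by (simp add: power2_eq_square mult_left_le)
qed auto

text \<open>The mean of the values \<open>\<psi> t b\<close> with themselves as weights, hence no
  larger than their supremum. The squares inherit the tail estimate, which makes this lower bound
  continuous.\<close>

definition sumsq :: "'a \<Rightarrow> real" where
  "sumsq b = (\<Sum>\<^sub>\<infinity>t\<in>I. (\<psi> t b)\<^sup>2)"

text \<open>Values in [0, 1] dominate their squares, so \<open>uniform_tail\<close> also controls
  the tail of the squares: near \<open>b\<close> the function is within e/3 of a finite continuous
  sum.\<close>

lemma sumsq_tendsto:
  assumes b: "b \<in> topspace X"
  shows "(sumsq \<longlongrightarrow> sumsq b) (nhdsin X b)"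
proof (rule tendstoI)
  fix e :: real assume e: "0 < e"
  then have e3: "0 < e/3" by simp
  obtain F where F: "finite F" "F \<subseteq> {t\<in>I. b \<in> U t}"
    and "eventually (\<lambda>x. \<forall>G. finite G \<longrightarrow> G \<subseteq> I - F \<longrightarrow> (\<Sum>t\<in>G. \<psi> t x) < e/3) (nhdsin X b)"
    by (rule uniform_tail[OF b e3])
  from this(3) eventually_in_topspace[OF b]
  have tail: "eventually (\<lambda>x. \<bar>sumsq x - (\<Sum>t\<in>F. (\<psi> t x)\<^sup>2)\<bar> \<le> e/3) (nhdsin X b)"
  proof eventually_elim
    case (elim x)
    have sm: "(\<lambda>t. (\<psi> t x)\<^sup>2) summable_on I - F"
      using summable_zero_ext_power2[OF elim(2)] by (rule summable_on_subset_banach) auto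
    have "sumsq x = infsum (\<lambda>t. (\<psi> t x)\<^sup>2) (F \<union> (I - F))"
      unfolding sumsq_def using F by (intro arg_cong[of _ _ "infsum _"]) auto
    also have "\<dots> = (\<Sum>t\<in>F. (\<psi> t x)\<^sup>2) + infsum (\<lambda>t. (\<psi> t x)\<^sup>2) (I - F)"
      using F sm by (subst infsum_Un_disjoint) auto
    finally have "sumsq x - (\<Sum>t\<in>F. (\<psi> t x)\<^sup>2) = infsum (\<lambda>t. (\<psi> t x)\<^sup>2) (I - F)"
      by simp
    moreover have "infsum (\<lambda>t. (\<psi> t x)\<^sup>2) (I - F) \<le> e/3"
    proof (rule infsum_le_finite_sums[OF sm])
      fix G assume G: "finite G" "G \<subseteq> I - F"
      have "(\<Sum>t\<in>G. (\<psi> t x)\<^sup>2) \<le> (\<Sum>t\<in>G. \<psi> t x)"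
        using G zero_ext_nonneg zero_ext_le_1[OF elim(2)]
        by (intro sum_mono) (auto simp: power2_eq_square intro!: mult_left_le)
      also have "\<dots> < e/3"
        using elim G by blast
      finally show "(\<Sum>t\<in>G. (\<psi> t x)\<^sup>2) \<le> e/3" by simp
    qed
    moreover have "0 \<le> infsum (\<lambda>t. (\<psi> t x)\<^sup>2) (I - F)"
      by (rule infsum_nonneg) simp
    ultimately show ?case by simp
  qed
  have "((\<lambda>x. \<Sum>t\<in>F. (\<psi> t x)\<^sup>2) \<longlongrightarrow> (\<Sum>t\<in>F. (\<psi> t b)\<^sup>2)) (nhdsin X b)"
    using F b by (intro tendsto_sum tendsto_power zero_ext_tendsto) auto
  then have "eventually (\<lambda>x. dist (\<Sum>t\<in>F. (\<psi> t x)\<^sup>2) (\<Sum>t\<in>F. (\<psi> t b)\<^sup>2) < e/3) (nhdsin X b)"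
    using e by (intro tendstoD) auto
  \<comment> \<open>Three errors of e/3: the tail at \<open>x\<close>, the tail at \<open>b\<close>
    and the change of the finite sum. The neighbourhood contains \<open>b\<close>, so the tail bound
    may be read off there too.\<close>
  from this tail show "eventually (\<lambda>x. dist (sumsq x) (sumsq b) < e) (nhdsin X b)"
    by eventually_elim
      (use eventually_nhdsin_self[OF tail b] in \<open>unfold dist_real_def, linarith\<close>)
qed

text \<open>If every value were at most s/2, where s is the sum of squares, then s \<le> (s/2) * 1,
  contradicting s > 0. The factor 1/2 leaves room for a strict inequality: where one function equals
  1, s is itself the maximum.\<close>

lemma sumsq_less_zero_ext:
  assumes b: "b \<in> topspace X"
  shows "0 < sumsq b" "\<exists>t\<in>I. sumsq b / 2 < \<psi> t b"
proof -
  obtain t where t: "t \<in> I" "\<psi> t b \<noteq> 0"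
  proof (rule ccontr)
    assume "\<not> thesis"
    then have "((\<lambda>t. \<psi> t b) has_sum 0) I"
      using that by (intro has_sum_0) auto
    then show False
      using has_sum_unique[OF zero_ext_has_sum[OF b]] by force
  qed
  have "(\<psi> t b)\<^sup>2 \<le> sumsq b"
    unfolding sumsq_def
    using finite_sum_le_infsum[OF summable_zero_ext_power2[OF b], of "{t}"] t by simp
  then show pos: "0 < sumsq b"
    using t by (meson less_le_trans zero_less_power2)
  show "\<exists>t\<in>I. sumsq b / 2 < \<psi> t b"
  proof (rule ccontr)
    assume "\<not> ?thesis"
    then have le: "\<psi> t b \<le> sumsq b / 2" if "t \<in> I" for t
      using that by force
    have hs: "((\<lambda>t. (sumsq b / 2) * \<psi> t b) has_sum (sumsq b / 2) * 1) I"
      by (intro has_sum_cmult_right zero_ext_has_sum b)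
    have "((\<lambda>t. (\<psi> t b)\<^sup>2) has_sum sumsq b) I"
      unfolding sumsq_def using summable_zero_ext_power2[OF b] by (rule has_sum_infsum)
    then have "sumsq b \<le> (sumsq b / 2) * 1"
      using hs
      by (rule has_sum_mono)
        (unfold power2_eq_square, rule mult_right_mono[OF le zero_ext_nonneg])
    then show False
      using pos by simp
  qed
qed

text \<open>
  Subtracting half of the continuous positive function \<open>\<Sum>t. \<psi>\<^sub>t\<^sup>2\<close>, which is smaller than \<open>max\<^sub>t \<psi>\<^sub>t\<close>,
  and truncating at \<open>0\<close> makes the supports locally finite and moves them inside the \<open>U t\<close>.
\<close>
lemma locally_finite_partition_subordinate:
  obtains \<rho> :: "'i \<Rightarrow> 'a \<Rightarrow> real"
  where "\<And>t b. t \<in> I \<Longrightarrow> b \<in> topspace X \<Longrightarrow> (\<rho> t \<longlongrightarrow> \<rho> t b) (nhdsin X b)"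
    "\<And>t b. t \<in> I \<Longrightarrow> b \<in> topspace X - U t \<Longrightarrow> eventually (\<lambda>x. \<rho> t x = 0) (nhdsin X b)"
    "\<And>b. b \<in> topspace X \<Longrightarrow>
      \<exists>F. finite F \<and> F \<subseteq> I \<and> eventually (\<lambda>x. \<forall>t\<in>I - F. \<rho> t x = 0) (nhdsin X b)"
    "\<And>b F. b \<in> topspace X \<Longrightarrow> finite F \<Longrightarrow> F \<subseteq> I \<Longrightarrow> (\<forall>t\<in>I - F. \<rho> t b = 0) \<Longrightarrow> (\<Sum>t\<in>F. \<rho> t b) = 1"
proof -
  define \<mu> where "\<mu> t b = max 0 (\<psi> t b - sumsq b / 2)" for t b
  define S where "S b = (\<Sum>\<^sub>\<infinity>t\<in>I. \<mu> t b)" for b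
  have \<mu>_tendsto: "(\<mu> t \<longlongrightarrow> \<mu> t b) (nhdsin X b)" if "t \<in> I" "b \<in> topspace X" for t b
    unfolding \<mu>_def using that by (intro tendsto_intros zero_ext_tendsto sumsq_tendsto) auto
  have \<mu>_supp: "eventually (\<lambda>x. \<mu> t x = 0) (nhdsin X b)" if "t \<in> I" "b \<in> topspace X - U t" for t b
  proof -
    \<comment> \<open>The value at \<open>b\<close> is 0, so the difference has a negative limit;
      truncation then gives 0 on a whole neighbourhood and not only at \<open>b\<close>.\<close>
    have "((\<lambda>x. \<psi> t x - sumsq x / 2) \<longlongrightarrow> 0 - sumsq b / 2) (nhdsin X b)"
      using that zero_ext_tendsto[of t b] by (intro tendsto_intros sumsq_tendsto) (auto simp: zero_ext_def[of U \<phi> t b])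
    then have "eventually (\<lambda>x. \<psi> t x - sumsq x / 2 < 0) (nhdsin X b)"
      using sumsq_less_zero_ext(1)[of b] that by (intro order_tendstoD(2)) auto
    then show ?thesis
      by eventually_elim (simp add: \<mu>_def)
  qed
  have \<mu>_lf: "\<exists>F. finite F \<and> F \<subseteq> I \<and> eventually (\<lambda>x. \<forall>t\<in>I - F. \<mu> t x = 0) (nhdsin X b)"
    if b: "b \<in> topspace X" for b
  proof -
    \<comment> \<open>Near \<open>b\<close> the subtracted half exceeds a quarter of
      \<open>sumsq b\<close>, because \<open>sumsq\<close> stays above half its value; tail terms
      below that quarter are truncated to 0.\<close>
    have pos: "0 < sumsq b / 4"
      using sumsq_less_zero_ext(1)[OF b] by simp
    obtain F where F: "finite F" "F \<subseteq> {t\<in>I. b \<in> U t}"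
      and ev: "eventually (\<lambda>x. \<forall>G. finite G \<longrightarrow> G \<subseteq> I - F \<longrightarrow> (\<Sum>t\<in>G. \<psi> t x) < sumsq b / 4) (nhdsin X b)"
      by (rule uniform_tail[OF b pos])
    have "eventually (\<lambda>x. sumsq b / 2 < sumsq x) (nhdsin X b)"
      using pos by (intro order_tendstoD(1)[OF sumsq_tendsto[OF b]]) simp
    from this ev have "eventually (\<lambda>x. \<forall>t\<in>I - F. \<mu> t x = 0) (nhdsin X b)"
    proof eventually_elim
      case (elim x)
      show ?case
      proof
        fix t assume "t \<in> I - F"
        then have "(\<Sum>t\<in>{t}. \<psi> t x) < sumsq b / 4"
          using elim(2) by blast
        then show "\<mu> t x = 0"
          using elim(1) by (simp add: \<mu>_def)
      qed
    qed
    with F show ?thesis by (intro exI[of _ F]) auto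
  qed
  have S_eq: "S b = (\<Sum>t\<in>F. \<mu> t b)" if "finite F" "F \<subseteq> I" "\<forall>t\<in>I - F. \<mu> t b = 0" for F b
  proof -
    have "S b = infsum (\<lambda>t. \<mu> t b) F"
      unfolding S_def using that by (intro infsum_cong_neutral) auto
    then show ?thesis using that by simp
  qed
  have S_tendsto: "(S \<longlongrightarrow> S b) (nhdsin X b)" if b: "b \<in> topspace X" for b
  proof -
    obtain F where F: "finite F" "F \<subseteq> I" "eventually (\<lambda>x. \<forall>t\<in>I - F. \<mu> t x = 0) (nhdsin X b)"
      using \<mu>_lf[OF b] by blast
    have "((\<lambda>x. \<Sum>t\<in>F. \<mu> t x) \<longlongrightarrow> (\<Sum>t\<in>F. \<mu> t b)) (nhdsin X b)"
      using F b by (intro tendsto_sum \<mu>_tendsto) auto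
    moreover have "eventually (\<lambda>x. (\<Sum>t\<in>F. \<mu> t x) = S x) (nhdsin X b)"
      using F(3) by eventually_elim (use F S_eq in auto)
    ultimately have "(S \<longlongrightarrow> (\<Sum>t\<in>F. \<mu> t b)) (nhdsin X b)"
      by (rule Lim_transform_eventually)
    then show ?thesis
      using S_eq[OF F(1,2) eventually_nhdsin_self[OF F(3) b]] by simp
  qed
  have S_pos: "0 < S b" if b: "b \<in> topspace X" for b
  proof -
    obtain F where F: "finite F" "F \<subseteq> I" "eventually (\<lambda>x. \<forall>t\<in>I - F. \<mu> t x = 0) (nhdsin X b)"
      using \<mu>_lf[OF b] by blast
    note F3 = eventually_nhdsin_self[OF F(3) b]
    obtain t where t: "t \<in> I" "sumsq b / 2 < \<psi> t b"
      using sumsq_less_zero_ext(2)[OF b] by blast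
    then have "0 < \<mu> t b" by (simp add: \<mu>_def)
    moreover from this have "t \<in> F" using F3 t by force
    moreover have "0 \<le> \<mu> s b" for s by (simp add: \<mu>_def)
    ultimately have "0 < (\<Sum>t\<in>F. \<mu> t b)"
      using F by (intro sum_pos2) auto
    then show ?thesis
      using S_eq[OF F(1,2) F3] by simp
  qed
  \<comment> \<open>Division by the positive continuous total \<open>S\<close> restores the sum 1
    and keeps the supports.\<close>
  define \<rho> where "\<rho> t b = \<mu> t b / S b" for t b
  show thesis
  proof (rule that[of \<rho>])
    show "(\<rho> t \<longlongrightarrow> \<rho> t b) (nhdsin X b)" if "t \<in> I" "b \<in> topspace X" for t b
      unfolding \<rho>_def using that S_pos[of b] by (intro tendsto_divide \<mu>_tendsto S_tendsto) auto
    show "eventually (\<lambda>x. \<rho> t x = 0) (nhdsin X b)" if "t \<in> I" "b \<in> topspace X - U t" for t b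
      using \<mu>_supp[OF that] by eventually_elim (simp add: \<rho>_def)
    show "\<exists>F. finite F \<and> F \<subseteq> I \<and> eventually (\<lambda>x. \<forall>t\<in>I - F. \<rho> t x = 0) (nhdsin X b)"
      if b: "b \<in> topspace X" for b
    proof -
      obtain F where F: "finite F" "F \<subseteq> I" "eventually (\<lambda>x. \<forall>t\<in>I - F. \<mu> t x = 0) (nhdsin X b)"
        using \<mu>_lf[OF b] by blast
      from F(3) have "eventually (\<lambda>x. \<forall>t\<in>I - F. \<rho> t x = 0) (nhdsin X b)"
        by eventually_elim (simp add: \<rho>_def)
      with F show ?thesis by blast
    qed
    show "(\<Sum>t\<in>F. \<rho> t b) = 1"
      if "b \<in> topspace X" "finite F" "F \<subseteq> I" "\<forall>t\<in>I - F. \<rho> t b = 0" for b F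
    proof -
      have "\<forall>t\<in>I - F. \<mu> t b = 0"
        using that S_pos[of b] by (auto simp: \<rho>_def)
      then have "S b = (\<Sum>t\<in>F. \<mu> t b)"
        using that S_eq by blast
      then show ?thesis
        using S_pos[of b] that by (simp add: \<rho>_def flip: sum_divide_distrib)
    qed
  qed
qed

end

section \<open>Cohomology and connecting homomorphisms\<close>

locale cochain_groups =
  fixes C :: "nat \<Rightarrow> 'g monoid" and d :: "nat \<Rightarrow> 'g \<Rightarrow> 'g"
  assumes comm: "comm_group (C n)" and d_hom: "d n \<in> hom (C n) (C (Suc n))"
begin

lemma is_group: "group (C n)"
  using comm by (rule comm_group.axioms)

lemma d_group_hom: "group_hom (C n) (C (Suc n)) (d n)"
  by (simp add: group_hom_def group_hom_axioms_def is_group d_hom)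

lemma subgroup_coboundaries: "subgroup (coboundaries C d n) (C n)"
proof (cases n)
  case 0
  then show ?thesis using group.triv_subgroup[OF is_group] by simp
next
  case (Suc m)
  then show ?thesis using group_hom.img_is_subgroup[OF d_group_hom] by simp
qed

lemma coboundaries_carrier: "x \<in> coboundaries C d n \<Longrightarrow> x \<in> carrier (C n)"
  using subgroup.subset[OF subgroup_coboundaries] by blast

lemma cocycles_iff: "x \<in> cocycles C d n \<longleftrightarrow> x \<in> carrier (C n) \<and> d n x = \<one>\<^bsub>C (Suc n)\<^esub>"
  by (auto simp: cocycles_def kernel_def)

lemma cocycles_mult:
  "x \<in> cocycles C d n \<Longrightarrow> y \<in> cocycles C d n \<Longrightarrow> x \<otimes>\<^bsub>C n\<^esub> y \<in> cocycles C d n"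
  using group_hom.subgroup_kernel[OF d_group_hom] by (auto simp: cocycles_def intro: subgroup.m_closed)

lemma carrier_cohomology: "carrier (cohomology C d n) = coho_class C d n ` cocycles C d n"
  by (auto simp: cohomology_def FactGroup_def RCOSETS_def r_coset_def coho_class_def)

text \<open>The carrier of the quotient is cut down to cocycles, but its operation is still the
  product of cosets in the abelian group \<open>C n\<close>; normality of the coboundaries there
  settles all representatives.\<close>

lemma mult_cohomology:
  assumes "x \<in> carrier (C n)" "y \<in> carrier (C n)"
  shows "coho_class C d n x \<otimes>\<^bsub>cohomology C d n\<^esub> coho_class C d n y = coho_class C d n (x \<otimes>\<^bsub>C n\<^esub> y)"
proof -
  have "coboundaries C d n \<lhd> C n"
    using comm_group.subgroup_imp_normal[OF comm subgroup_coboundaries] .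
  then show ?thesis
    using assms
    by (simp add: cohomology_def FactGroup_def coho_class_def normal.rcos_sum[symmetric] set_mult_def)
qed

lemma coho_class_mem_iff:
  "x \<in> coho_class C d n y \<longleftrightarrow> (\<exists>z\<in>coboundaries C d n. x = z \<otimes>\<^bsub>C n\<^esub> y)"
  by (auto simp: coho_class_def r_coset_def)

lemma coho_class_self: "x \<in> carrier (C n) \<Longrightarrow> x \<in> coho_class C d n x"
  unfolding coho_class_def using is_group subgroup_coboundaries by (metis group.rcos_self)

lemma coho_class_eq_iff:
  assumes "x \<in> carrier (C n)" "y \<in> carrier (C n)"
  shows "coho_class C d n x = coho_class C d n y \<longleftrightarrow> (\<exists>z\<in>coboundaries C d n. x = z \<otimes>\<^bsub>C n\<^esub> y)"
proof
  assume "coho_class C d n x = coho_class C d n y"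
  then show "\<exists>z\<in>coboundaries C d n. x = z \<otimes>\<^bsub>C n\<^esub> y"
    using coho_class_self[OF assms(1)] coho_class_mem_iff by blast
next
  assume "\<exists>z\<in>coboundaries C d n. x = z \<otimes>\<^bsub>C n\<^esub> y"
  then have "x \<in> coboundaries C d n #>\<^bsub>C n\<^esub> y"
    by (auto simp: r_coset_def)
  then show "coho_class C d n x = coho_class C d n y"
    unfolding coho_class_def
    using group.repr_independence[OF is_group _ _ subgroup_coboundaries] assms by metis
qed

end

text \<open>A short exact sequence of complexes in multiplicative notation. \<open>dd\<close> is
  stated for the middle complex; injectivity of \<open>i\<close> carries what it yields over to
  \<open>A\<close>.\<close>

locale short_exact_cochains = A: cochain_groups A dA + B: cochain_groups B dB + C: cochain_groups C dC
  for A :: "nat \<Rightarrow> 'g monoid" and dA and B :: "nat \<Rightarrow> 'h monoid" and dB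
    and C :: "nat \<Rightarrow> 'k monoid" and dC +
  fixes i :: "nat \<Rightarrow> 'g \<Rightarrow> 'h" and p :: "nat \<Rightarrow> 'h \<Rightarrow> 'k"
  assumes i_hom: "i n \<in> hom (A n) (B n)" and p_hom: "p n \<in> hom (B n) (C n)"
    and i_inj: "inj_on (i n) (carrier (A n))"
    and p_surj: "p n ` carrier (B n) = carrier (C n)"
    and exact: "kernel (B n) (C n) (p n) = i n ` carrier (A n)"
    and i_d: "x \<in> carrier (A n) \<Longrightarrow> i (Suc n) (dA n x) = dB n (i n x)"
    and p_d: "y \<in> carrier (B n) \<Longrightarrow> p (Suc n) (dB n y) = dC n (p n y)"
    and dd: "y \<in> carrier (B n) \<Longrightarrow> dB (Suc n) (dB n y) = \<one>\<^bsub>B (Suc (Suc n))\<^esub>"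
begin

text \<open>The shape of \<open>connecting\<close> for arbitrary complexes, so that
  \<open>Delta\<close> becomes an instance by unfolding.\<close>

definition connect :: "nat \<Rightarrow> 'k set \<Rightarrow> 'g set" where
  "connect n c = the_elem {coho_class A dA (Suc n) a | a g.
     a \<in> carrier (A (Suc n)) \<and> g \<in> carrier (B n) \<and> p n g \<in> c \<and> i (Suc n) a = dB n g}"

lemma i_group_hom: "group_hom (A n) (B n) (i n)"
  by (simp add: group_hom_def group_hom_axioms_def A.is_group B.is_group i_hom)

lemma p_group_hom: "group_hom (B n) (C n) (p n)"
  by (simp add: group_hom_def group_hom_axioms_def B.is_group C.is_group p_hom)

lemma p_i: "x \<in> carrier (A n) \<Longrightarrow> p n (i n x) = \<one>\<^bsub>C n\<^esub>"
  using exact[of n] by (auto simp: kernel_def)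

lemma i_closed: "x \<in> carrier (A n) \<Longrightarrow> i n x \<in> carrier (B n)"
  using i_hom by (auto simp: hom_def)

lemma p_closed: "x \<in> carrier (B n) \<Longrightarrow> p n x \<in> carrier (C n)"
  using p_hom by (auto simp: hom_def)

lemma dA_closed: "x \<in> carrier (A n) \<Longrightarrow> dA n x \<in> carrier (A (Suc n))"
  using A.d_hom by (auto simp: hom_def)

lemma dB_closed: "x \<in> carrier (B n) \<Longrightarrow> dB n x \<in> carrier (B (Suc n))"
  using B.d_hom by (auto simp: hom_def)

lemma i_eqD: "i n x = i n y \<Longrightarrow> x \<in> carrier (A n) \<Longrightarrow> y \<in> carrier (A n) \<Longrightarrow> x = y"
  using i_inj by (rule inj_onD)

lemma d_coboundary: "y \<in> coboundaries B dB n \<Longrightarrow> dB n y = \<one>\<^bsub>B (Suc n)\<^esub>"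
  by (cases n) (auto simp: dd group_hom.hom_one[OF B.d_group_hom])

text \<open>Since \<open>p\<close> is onto in the previous degree and commutes with the
  differentials, a change of representative by a coboundary of \<open>C\<close> lifts to a change by
  a coboundary of \<open>B\<close>, which \<open>dB\<close> kills.\<close>

lemma p_coboundaries: "p n ` coboundaries B dB n = coboundaries C dC n"
proof (cases n)
  case 0
  then show ?thesis by (simp add: group_hom.hom_one[OF p_group_hom])
next
  case (Suc m)
  have "p (Suc m) ` dB m ` carrier (B m) = dC m ` p m ` carrier (B m)"
    by (auto simp: p_d image_image)
  then show ?thesis using Suc by (simp add: p_surj)
qed

text \<open>\<open>p\<close> sends \<open>dB n g\<close> to 1, so exactness gives \<open>a\<close>.
  Injectivity of \<open>i\<close> turns the vanishing of the double differential of \<open>g\<close>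
  into the cocycle condition for \<open>a\<close>.\<close>

lemma lift_cocycle:
  assumes g: "g \<in> carrier (B n)" and cyc: "p n g \<in> cocycles C dC n"
  obtains a where "a \<in> cocycles A dA (Suc n)" "i (Suc n) a = dB n g"
proof -
  have "p (Suc n) (dB n g) = \<one>\<^bsub>C (Suc n)\<^esub>"
    using cyc g by (simp add: p_d C.cocycles_iff)
  then have "dB n g \<in> i (Suc n) ` carrier (A (Suc n))"
    unfolding exact[symmetric] using dB_closed[OF g] by (simp add: kernel_def)
  then obtain a where a: "a \<in> carrier (A (Suc n))" "i (Suc n) a = dB n g" by auto
  have "i (Suc (Suc n)) (dA (Suc n) a) = i (Suc (Suc n)) \<one>\<^bsub>A (Suc (Suc n))\<^esub>"
    using a dd[OF g] by (simp add: i_d group_hom.hom_one[OF i_group_hom])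
  then have "dA (Suc n) a = \<one>\<^bsub>A (Suc (Suc n))\<^esub>"
    by (rule i_eqD) (use a dA_closed A.is_group group.is_monoid monoid.one_closed in \<open>blast+\<close>)
  with a that show thesis by (simp add: A.cocycles_iff)
qed

lemma p_fibre:
  assumes "g \<in> carrier (B n)" "g' \<in> carrier (B n)" "p n g = p n g'"
  obtains z where "z \<in> carrier (A n)" "g = i n z \<otimes>\<^bsub>B n\<^esub> g'"
proof -
  interpret Bn: group "B n" by (rule B.is_group)
  interpret p: group_hom "B n" "C n" "p n" by (rule p_group_hom)
  have "p n (g \<otimes>\<^bsub>B n\<^esub> inv\<^bsub>B n\<^esub> g') = \<one>\<^bsub>C n\<^esub>"
    using assms by (simp add: p_closed)
  then have "g \<otimes>\<^bsub>B n\<^esub> inv\<^bsub>B n\<^esub> g' \<in> i n ` carrier (A n)"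
    unfolding exact[symmetric] using assms by (simp add: kernel_def)
  then obtain z where z: "z \<in> carrier (A n)" "g \<otimes>\<^bsub>B n\<^esub> inv\<^bsub>B n\<^esub> g' = i n z" by auto
  then have "g = i n z \<otimes>\<^bsub>B n\<^esub> g'"
    using assms by (metis Bn.inv_closed Bn.inv_solve_right' Bn.m_closed)
  with z that show thesis by blast
qed

text \<open>Two choices of lift differ by a coboundary of \<open>B\<close> and an element
  \<open>i n z\<close> of the kernel of \<open>p\<close>. The differential kills the first and turns
  the second into the image of \<open>dA n z\<close>, so the class of \<open>a\<close> is
  unchanged.\<close>

lemma connect_eq:
  assumes g: "g \<in> carrier (B n)" and a: "a \<in> carrier (A (Suc n))" "i (Suc n) a = dB n g"
  shows "connect n (coho_class C dC n (p n g)) = coho_class A dA (Suc n) a"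
proof -
  have "coho_class A dA (Suc n) a' = coho_class A dA (Suc n) a"
    if a': "a' \<in> carrier (A (Suc n))" and g': "g' \<in> carrier (B n)"
      and cl: "p n g' \<in> coho_class C dC n (p n g)" and eq: "i (Suc n) a' = dB n g'" for a' g'
  proof -
    interpret Bn: group "B n" by (rule B.is_group)
    interpret Bn1: group "B (Suc n)" by (rule B.is_group)
    interpret An1: group "A (Suc n)" by (rule A.is_group)
    obtain w where w: "w \<in> coboundaries B dB n" "p n g' = p n w \<otimes>\<^bsub>C n\<^esub> p n g"
      using cl unfolding C.coho_class_mem_iff p_coboundaries[symmetric] by blast
    have wB: "w \<in> carrier (B n)"
      using w B.coboundaries_carrier by blast
    have "p n g' = p n (w \<otimes>\<^bsub>B n\<^esub> g)"
      using w wB g hom_mult[OF p_hom] by metis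
    then obtain z where z: "z \<in> carrier (A n)" "g' = i n z \<otimes>\<^bsub>B n\<^esub> (w \<otimes>\<^bsub>B n\<^esub> g)"
      using p_fibre g g' wB Bn.m_closed by metis
    have "i (Suc n) a' = dB n (i n z) \<otimes>\<^bsub>B (Suc n)\<^esub> (dB n w \<otimes>\<^bsub>B (Suc n)\<^esub> dB n g)"
      using eq z wB g by (simp add: hom_mult[OF B.d_hom] i_closed)
    also have "\<dots> = dB n (i n z) \<otimes>\<^bsub>B (Suc n)\<^esub> dB n g"
      using w g by (simp add: d_coboundary dB_closed)
    also have "\<dots> = i (Suc n) (dA n z \<otimes>\<^bsub>A (Suc n)\<^esub> a)"
      using z a by (simp add: hom_mult[OF i_hom] dA_closed i_d)
    finally have "a' = dA n z \<otimes>\<^bsub>A (Suc n)\<^esub> a"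
      by (rule i_eqD) (use z a a' dA_closed in auto)
    then show ?thesis
      using z a' a by (subst A.coho_class_eq_iff) auto
  qed
  moreover have "p n g \<in> coho_class C dC n (p n g)"
    using g by (intro C.coho_class_self p_closed)
  ultimately have "{coho_class A dA (Suc n) a' | a' g'. a' \<in> carrier (A (Suc n)) \<and> g' \<in> carrier (B n) \<and>
      p n g' \<in> coho_class C dC n (p n g) \<and> i (Suc n) a' = dB n g'} = {coho_class A dA (Suc n) a}"
    using g a by blast
  then show ?thesis
    by (simp add: connect_def)
qed

lemma cohomology_representative:
  assumes "c \<in> carrier (cohomology C dC n)"
  obtains g a where "g \<in> carrier (B n)" "p n g \<in> cocycles C dC n" "c = coho_class C dC n (p n g)"
    "a \<in> cocycles A dA (Suc n)" "i (Suc n) a = dB n g"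
proof -
  obtain x where x: "x \<in> cocycles C dC n" "c = coho_class C dC n x"
    using assms unfolding C.carrier_cohomology by blast
  then have "x \<in> p n ` carrier (B n)"
    unfolding p_surj by (simp add: C.cocycles_iff)
  then obtain g where g: "g \<in> carrier (B n)" "x = p n g" by blast
  from x g have "p n g \<in> cocycles C dC n" by simp
  from lift_cocycle[OF g(1) this] obtain a where "a \<in> cocycles A dA (Suc n)" "i (Suc n) a = dB n g" .
  with x g that show thesis by blast
qed

text \<open>In the long exact sequence the neighbours of \<open>connect n\<close> are the cohomology
  groups of \<open>B\<close> in degrees \<open>n\<close> and \<open>Suc n\<close>. Vanishing in
  degree \<open>n\<close> gives injectivity, vanishing in degree \<open>Suc n\<close>
  surjectivity.\<close>

theorem connect_iso:
  assumes "cocycles B dB n \<subseteq> coboundaries B dB n"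
    and "cocycles B dB (Suc n) \<subseteq> coboundaries B dB (Suc n)"
  shows "connect n \<in> iso (cohomology C dC n) (cohomology A dA (Suc n))"
proof (rule isoI)
  interpret Bn: group "B n" by (rule B.is_group)
  interpret Bn1: group "B (Suc n)" by (rule B.is_group)
  interpret An1: group "A (Suc n)" by (rule A.is_group)
  interpret Cn: group "C n" by (rule C.is_group)
  note closed = A.cocycles_iff B.cocycles_iff C.cocycles_iff p_closed i_closed dA_closed dB_closed
  show "connect n \<in> hom (cohomology C dC n) (cohomology A dA (Suc n))"
  proof (rule homI)
    fix c assume "c \<in> carrier (cohomology C dC n)"
    then show "connect n c \<in> carrier (cohomology A dA (Suc n))"
      by (rule cohomology_representative)
        (auto simp: connect_eq A.carrier_cohomology A.cocycles_iff)
  next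
    fix c c' assume "c \<in> carrier (cohomology C dC n)" "c' \<in> carrier (cohomology C dC n)"
    then obtain g a g' a' where
      g: "g \<in> carrier (B n)" "p n g \<in> cocycles C dC n" "c = coho_class C dC n (p n g)"
        "a \<in> cocycles A dA (Suc n)" "i (Suc n) a = dB n g"
      and g': "g' \<in> carrier (B n)" "p n g' \<in> cocycles C dC n" "c' = coho_class C dC n (p n g')"
        "a' \<in> cocycles A dA (Suc n)" "i (Suc n) a' = dB n g'"
      by (meson cohomology_representative)
    have aA: "a \<in> carrier (A (Suc n))" "a' \<in> carrier (A (Suc n))"
      using g g' by (auto simp: closed)
    have "c \<otimes>\<^bsub>cohomology C dC n\<^esub> c' = coho_class C dC n (p n (g \<otimes>\<^bsub>B n\<^esub> g'))"
      using g g' by (simp add: C.mult_cohomology p_closed hom_mult[OF p_hom])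
    moreover have "connect n \<dots> = coho_class A dA (Suc n) (a \<otimes>\<^bsub>A (Suc n)\<^esub> a')"
      using g g' aA by (intro connect_eq) (simp_all add: hom_mult[OF i_hom] hom_mult[OF B.d_hom])
    moreover have "connect n c = coho_class A dA (Suc n) a" "connect n c' = coho_class A dA (Suc n) a'"
      using g g' aA by (simp_all add: connect_eq)
    ultimately show "connect n (c \<otimes>\<^bsub>cohomology C dC n\<^esub> c') =
        connect n c \<otimes>\<^bsub>cohomology A dA (Suc n)\<^esub> connect n c'"
      using aA by (simp add: A.mult_cohomology)
  qed
  show "bij_betw (connect n) (carrier (cohomology C dC n)) (carrier (cohomology A dA (Suc n)))"
  proof (rule bij_betw_imageI)
    show "inj_on (connect n) (carrier (cohomology C dC n))"
    proof (rule inj_onI)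
      fix c c' assume "c \<in> carrier (cohomology C dC n)" "c' \<in> carrier (cohomology C dC n)"
        and eq: "connect n c = connect n c'"
      then obtain g a g' a' where
        g: "g \<in> carrier (B n)" "p n g \<in> cocycles C dC n" "c = coho_class C dC n (p n g)"
          "a \<in> cocycles A dA (Suc n)" "i (Suc n) a = dB n g"
        and g': "g' \<in> carrier (B n)" "p n g' \<in> cocycles C dC n" "c' = coho_class C dC n (p n g')"
          "a' \<in> cocycles A dA (Suc n)" "i (Suc n) a' = dB n g'"
        by (meson cohomology_representative)
      have aA: "a \<in> carrier (A (Suc n))" "a' \<in> carrier (A (Suc n))"
        using g g' by (auto simp: closed)
      have "coho_class A dA (Suc n) a = coho_class A dA (Suc n) a'"
        using eq g g' aA by (simp add: connect_eq)
      then obtain z where z: "z \<in> carrier (A n)" "a = dA n z \<otimes>\<^bsub>A (Suc n)\<^esub> a'"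
        using aA by (auto simp: A.coho_class_eq_iff)
      \<comment> \<open>Since \<open>i n z\<close> absorbs the difference of \<open>a\<close> and
        \<open>a'\<close>, this quotient is a cocycle of \<open>B\<close>, hence a coboundary;
        \<open>p\<close> kills \<open>i n z\<close>, so its image compares \<open>p n g\<close> with
        \<open>p n g'\<close>.\<close>
      let ?h = "g \<otimes>\<^bsub>B n\<^esub> inv\<^bsub>B n\<^esub> (i n z \<otimes>\<^bsub>B n\<^esub> g')"
      have "dB n g = dB n (i n z \<otimes>\<^bsub>B n\<^esub> g')"
        using g(5) g' z aA by (simp add: hom_mult[OF i_hom] hom_mult[OF B.d_hom] i_d closed)
      then have "dB n ?h = \<one>\<^bsub>B (Suc n)\<^esub>"
        using g g' z by (simp add: hom_mult[OF B.d_hom] group_hom.hom_inv[OF B.d_group_hom] closed)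
      then have h: "?h \<in> coboundaries B dB n"
        using assms(1) g g' z by (auto simp: closed)
      have "g = ?h \<otimes>\<^bsub>B n\<^esub> (i n z \<otimes>\<^bsub>B n\<^esub> g')"
        using g g' z by (simp add: closed Bn.m_assoc)
      then have "p n g = p n (?h \<otimes>\<^bsub>B n\<^esub> (i n z \<otimes>\<^bsub>B n\<^esub> g'))"
        by simp
      also have "\<dots> = p n ?h \<otimes>\<^bsub>C n\<^esub> (p n (i n z) \<otimes>\<^bsub>C n\<^esub> p n g')"
        using g g' z B.coboundaries_carrier[OF h] by (simp only: hom_mult[OF p_hom] closed Bn.m_closed)
      also have "\<dots> = p n ?h \<otimes>\<^bsub>C n\<^esub> p n g'"
        using z g' by (simp add: p_i closed)
      finally have "p n g = p n ?h \<otimes>\<^bsub>C n\<^esub> p n g'" .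
      moreover have "p n ?h \<in> coboundaries C dC n"
        using h unfolding p_coboundaries[symmetric] by blast
      ultimately show "c = c'"
        unfolding g(3) g'(3) using g g' by (subst C.coho_class_eq_iff) (auto simp: closed)
    qed
    show "connect n ` carrier (cohomology C dC n) = carrier (cohomology A dA (Suc n))"
    proof
      show "connect n ` carrier (cohomology C dC n) \<subseteq> carrier (cohomology A dA (Suc n))"
        by (clarify, erule cohomology_representative)
          (auto simp: connect_eq A.carrier_cohomology A.cocycles_iff)
      show "carrier (cohomology A dA (Suc n)) \<subseteq> connect n ` carrier (cohomology C dC n)"
      proof
        fix c assume "c \<in> carrier (cohomology A dA (Suc n))"
        then obtain a where a: "a \<in> carrier (A (Suc n))" "dA (Suc n) a = \<one>\<^bsub>A (Suc (Suc n))\<^esub>"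
            "c = coho_class A dA (Suc n) a"
          by (auto simp: A.carrier_cohomology A.cocycles_iff)
        then have "dB (Suc n) (i (Suc n) a) = \<one>\<^bsub>B (Suc (Suc n))\<^esub>"
          by (simp add: i_d[symmetric] group_hom.hom_one[OF i_group_hom])
        then have "i (Suc n) a \<in> coboundaries B dB (Suc n)"
          using assms(2) a by (auto simp: closed)
        \<comment> \<open>A primitive of the image of \<open>a\<close> in \<open>B\<close> is the
          required lift: \<open>p\<close> sends its differential to 1, so \<open>p n g\<close> is a
          cocycle.\<close>
        then obtain g where g: "g \<in> carrier (B n)" "i (Suc n) a = dB n g"
          by auto
        have "dC n (p n g) = \<one>\<^bsub>C (Suc n)\<^esub>"
          using g a by (simp add: p_d[symmetric] p_i flip: g(2))
        then have "coho_class C dC n (p n g) \<in> carrier (cohomology C dC n)"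
          using g by (auto simp: C.carrier_cohomology closed)
        then show "c \<in> connect n ` carrier (cohomology C dC n)"
          using connect_eq[OF g(1) a(1) g(2)] a(3) by force
      qed
    qed
  qed
qed

end

section \<open>Cech complexes of presheaves\<close>

lemma hom_finprod:
  assumes "comm_group G" "comm_group H" "h \<in> hom G H" "f \<in> A \<rightarrow> carrier G"
  shows "h (finprod G f A) = finprod H (\<lambda>a. h (f a)) A"
proof -
  interpret G: comm_group G by fact
  interpret H: comm_group H by fact
  interpret h: group_hom G H h
    by (simp add: group_hom_def group_hom_axioms_def assms G.is_group H.is_group)
  show ?thesis
    using assms(4)
  proof (induction A rule: infinite_finite_induct)
    case (insert a A)
    then have "f \<in> A \<rightarrow> carrier G" "f a \<in> carrier G" "(\<lambda>a. h (f a)) \<in> A \<rightarrow> carrier H"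
      by (auto simp: Pi_iff)
    with insert show ?case by simp
  qed auto
qed

lemma comm_group_product_group:
  assumes "\<And>i. i \<in> I \<Longrightarrow> comm_group (G i)"
  shows "comm_group (product_group I G)"
proof (rule group.group_comm_groupI)
  show "group (product_group I G)"
    using assms by (simp add: comm_group.axioms)
  show "x \<otimes>\<^bsub>product_group I G\<^esub> y = y \<otimes>\<^bsub>product_group I G\<^esub> x"
    if "x \<in> carrier (product_group I G)" "y \<in> carrier (product_group I G)" for x y
    using that assms
    by (auto simp: PiE_iff intro!: restrict_ext comm_monoid.m_comm comm_group.axioms)
qed

section \<open>Faces of tuples and alternating face sums\<close>

lemma length_omit: "r < length ks \<Longrightarrow> length (omit r ks) = length ks - 1"
  by (simp add: omit_def)

lemma set_omit: "set (omit r ks) \<subseteq> set ks"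
  by (auto simp: omit_def dest: in_set_takeD in_set_dropD)

lemma omit_0 [simp]: "omit 0 (k # ks) = ks"
  by (simp add: omit_def)

lemma omit_Suc [simp]: "omit (Suc r) (k # ks) = k # omit r ks"
  by (simp add: omit_def)

lemma omit_tuples: "ks \<in> tuples I (Suc n) \<Longrightarrow> r \<le> Suc n \<Longrightarrow> omit r ks \<in> tuples I n"
  using set_omit[of r ks] by (auto simp: tuples_def length_omit)

lemma overlap_omit: "overlap U ks \<subseteq> overlap U (omit r ks)"
  using set_omit[of r ks] by (auto simp: overlap_def)

lemma overlap_Cons: "overlap U (t # js) = U t \<inter> overlap U js"
  by (simp add: overlap_def)

lemma openin_overlap:
  assumes "open_cover X I U" "js \<in> tuples I n"
  shows "openin X (overlap U js)"
proof -
  have "openin X (\<Inter> (U ` set js))"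
    using assms by (intro openin_Inter) (auto simp: open_cover_def tuples_def)
  then show ?thesis by (simp add: overlap_def)
qed

text \<open>The Cech coboundary at a fixed point, stripped of the cover and allowed on lists of
  every length. Identities about faces are then proved once, by induction on the list.\<close>

definition face_sum :: "('i list \<Rightarrow> 'b::comm_ring_1) \<Rightarrow> 'i list \<Rightarrow> 'b" where
  "face_sum f ks = (\<Sum>j<length ks. (- 1) ^ j * f (omit j ks))"

lemma face_sum_Nil [simp]: "face_sum f [] = 0"
  by (simp add: face_sum_def)

text \<open>Splitting off the face without the head leaves the faces that keep it, with signs
  shifted by one. This recursion replaces all reindexing of double sums.\<close>

lemma face_sum_Cons: "face_sum f (k # ks) = f ks - face_sum (\<lambda>l. f (k # l)) ks"
proof -
  have "face_sum f (k # ks) = f ks + (\<Sum>j<length ks. (- 1) ^ Suc j * f (k # omit j ks))"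
    by (simp add: face_sum_def sum.lessThan_Suc_shift del: sum.lessThan_Suc)
  then show ?thesis
    by (simp add: face_sum_def sum_negf)
qed

lemma face_sum_cong:
  "(\<And>j. j < length ks \<Longrightarrow> f (omit j ks) = g (omit j ks)) \<Longrightarrow> face_sum f ks = face_sum g ks"
  by (simp add: face_sum_def)

lemma face_sum_diff: "face_sum (\<lambda>l. f l - g l) ks = face_sum f ks - face_sum g ks"
  by (simp add: face_sum_def algebra_simps sum_subtractf)

text \<open>By the recursion, applied twice, two copies of \<open>face_sum f ks\<close> cancel and
  the double sum of \<open>\<lambda>l. f (k # l)\<close> over \<open>ks\<close> remains; hence the
  induction over all \<open>f\<close>.\<close>

lemma face_sum_face_sum: "face_sum (face_sum f) ks = 0"
proof (induction ks arbitrary: f)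
  case (Cons k ks)
  then show ?case
    by (simp add: face_sum_Cons[of _ k] face_sum_diff)
qed simp

lemma face_sum_sum: "face_sum (\<lambda>l. \<Sum>t\<in>F. c t * f t l) ks = (\<Sum>t\<in>F. c t * face_sum (f t) ks)"
  unfolding face_sum_def sum_distrib_left
  by (subst sum.swap) (simp add: mult.left_commute)

section \<open>Cech cochains of a presheaf of abelian groups\<close>

locale abelian_presheaf =
  fixes X :: "'a topology" and F :: "('a, 'g) presheaf"
  assumes comm: "openin X V \<Longrightarrow> comm_group (sections F V)"
    and res_hom: "openin X V \<Longrightarrow> openin X W \<Longrightarrow> W \<subseteq> V \<Longrightarrow> res F V W \<in> hom (sections F V) (sections F W)"
begin

lemma is_group: "openin X V \<Longrightarrow> group (sections F V)"
  by (simp add: comm comm_group.axioms)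

context
  fixes I :: "'i set" and U :: "'i \<Rightarrow> 'a set"
  assumes cover: "open_cover X I U"
begin

definition face :: "('i list \<Rightarrow> 'g) \<Rightarrow> 'i list \<Rightarrow> nat \<Rightarrow> 'g" where
  "face f ks r = res F (overlap U (omit r ks)) (overlap U ks) (f (omit r ks))
     [^]\<^bsub>sections F (overlap U ks)\<^esub> ((- 1) ^ r :: int)"

lemma cech_coboundary_face:
  "ks \<in> tuples I (Suc n) \<Longrightarrow>
    cech_coboundary I U F n f ks = finprod (sections F (overlap U ks)) (face f ks) {..Suc n}"
  unfolding cech_coboundary_def face_def by (subst restrict_apply') auto

lemma carrier_cech:
  "f \<in> carrier (cech_cochains I U F n) \<longleftrightarrow>
     f \<in> extensional (tuples I n) \<and> (\<forall>js\<in>tuples I n. f js \<in> carrier (sections F (overlap U js)))"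
  by (auto simp: cech_cochains_def PiE_iff)

lemma comm_group_cech: "comm_group (cech_cochains I U F n)"
  unfolding cech_cochains_def
  by (intro comm_group_product_group comm openin_overlap[OF cover])

lemma res_face_closed:
  assumes "f \<in> carrier (cech_cochains I U F n)" "ks \<in> tuples I (Suc n)" "r \<le> Suc n"
  shows "res F (overlap U (omit r ks)) (overlap U ks) (f (omit r ks)) \<in> carrier (sections F (overlap U ks))"
  using assms omit_tuples[OF assms(2,3)]
    res_hom[OF openin_overlap[OF cover] openin_overlap[OF cover] overlap_omit]
  by (fastforce simp: carrier_cech hom_def)

lemma face_closed:
  assumes "f \<in> carrier (cech_cochains I U F n)" "ks \<in> tuples I (Suc n)" "r \<le> Suc n"
  shows "face f ks r \<in> carrier (sections F (overlap U ks))"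
  unfolding face_def
  using group.int_pow_closed[OF is_group[OF openin_overlap[OF cover assms(2)]] res_face_closed[OF assms]] .

lemma cech_coboundary_closed:
  assumes "f \<in> carrier (cech_cochains I U F n)"
  shows "cech_coboundary I U F n f \<in> carrier (cech_cochains I U F (Suc n))"
  unfolding carrier_cech
proof (intro conjI ballI)
  show "cech_coboundary I U F n f \<in> extensional (tuples I (Suc n))"
    by (simp add: cech_coboundary_def)
  fix ks assume ks: "ks \<in> tuples I (Suc n)"
  show "cech_coboundary I U F n f ks \<in> carrier (sections F (overlap U ks))"
    unfolding cech_coboundary_face[OF ks]
    using face_closed[OF assms ks]
    by (intro comm_monoid.finprod_closed comm_group.axioms comm openin_overlap[OF cover ks]) auto
qed

lemma cech_coboundary_hom:
  "cech_coboundary I U F n \<in> hom (cech_cochains I U F n) (cech_cochains I U F (Suc n))"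
proof (rule homI)
  fix f g assume f: "f \<in> carrier (cech_cochains I U F n)" and g: "g \<in> carrier (cech_cochains I U F n)"
  show "cech_coboundary I U F n (f \<otimes>\<^bsub>cech_cochains I U F n\<^esub> g) =
      cech_coboundary I U F n f \<otimes>\<^bsub>cech_cochains I U F (Suc n)\<^esub> cech_coboundary I U F n g" (is "?l = ?r")
  proof (rule extensionalityI)
    show "?l \<in> extensional (tuples I (Suc n))" "?r \<in> extensional (tuples I (Suc n))"
      by (simp_all add: cech_coboundary_def cech_cochains_def)
    fix ks assume ks: "ks \<in> tuples I (Suc n)"
    let ?S = "sections F (overlap U ks)"
    interpret S: comm_group ?S
      by (rule comm[OF openin_overlap[OF cover ks]])
    have "face (f \<otimes>\<^bsub>cech_cochains I U F n\<^esub> g) ks r = face f ks r \<otimes>\<^bsub>?S\<^esub> face g ks r" if r: "r \<le> Suc n" for r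
    proof -
      note om = omit_tuples[OF ks r]
      have "res F (overlap U (omit r ks)) (overlap U ks) ((f \<otimes>\<^bsub>cech_cochains I U F n\<^esub> g) (omit r ks)) =
          res F (overlap U (omit r ks)) (overlap U ks) (f (omit r ks)) \<otimes>\<^bsub>?S\<^esub>
          res F (overlap U (omit r ks)) (overlap U ks) (g (omit r ks))"
        using om f g
        hom_mult[OF res_hom[OF openin_overlap[OF cover om] openin_overlap[OF cover ks] overlap_omit]]
        by (simp add: carrier_cech) (simp add: cech_cochains_def)
      then show ?thesis
        using res_face_closed[OF f ks r] res_face_closed[OF g ks r]
        by (simp add: face_def S.int_pow_distrib)
    qed
    then have "?l ks = finprod ?S (\<lambda>r. face f ks r \<otimes>\<^bsub>?S\<^esub> face g ks r) {..Suc n}"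
      unfolding cech_coboundary_face[OF ks]
      using face_closed[OF f ks] face_closed[OF g ks] by (intro S.finprod_cong') auto
    also have "\<dots> = finprod ?S (face f ks) {..Suc n} \<otimes>\<^bsub>?S\<^esub> finprod ?S (face g ks) {..Suc n}"
      using face_closed[OF f ks] face_closed[OF g ks] by (intro S.finprod_multf) auto
    also have "\<dots> = ?r ks"
      using ks by (simp add: cech_cochains_def cech_coboundary_face[OF ks])
    finally show "?l ks = ?r ks" .
  qed
qed (rule cech_coboundary_closed)

lemma cochain_groups_cech: "cochain_groups (cech_cochains I U F) (cech_coboundary I U F)"
  by (intro cochain_groups.intro comm_group_cech cech_coboundary_hom)

end

end

section \<open>Cochain maps induced by presheaf morphisms\<close>

locale presheaf_morphism = F: abelian_presheaf X F + G: abelian_presheaf X G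
  for X :: "'a topology" and F :: "('a, 'g) presheaf" and G :: "('a, 'h) presheaf" +
  fixes m :: "'a set \<Rightarrow> 'g \<Rightarrow> 'h"
  assumes m_hom: "openin X V \<Longrightarrow> m V \<in> hom (sections F V) (sections G V)"
    and m_res: "openin X V \<Longrightarrow> openin X W \<Longrightarrow> W \<subseteq> V \<Longrightarrow> f \<in> carrier (sections F V) \<Longrightarrow>
      m W (res F V W f) = res G V W (m V f)"
begin

context
  fixes I :: "'i set" and U :: "'i \<Rightarrow> 'a set"
  assumes cover: "open_cover X I U"
begin

lemma cech_map_closed:
  "f \<in> carrier (cech_cochains I U F n) \<Longrightarrow> cech_map I U n m f \<in> carrier (cech_cochains I U G n)"
  by (auto simp: F.carrier_cech[OF cover] G.carrier_cech[OF cover] cech_map_def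
      intro!: hom_in_carrier[OF m_hom[OF openin_overlap[OF cover]]])

lemma cech_map_hom: "cech_map I U n m \<in> hom (cech_cochains I U F n) (cech_cochains I U G n)"
proof (rule homI)
  fix f g assume fg: "f \<in> carrier (cech_cochains I U F n)" "g \<in> carrier (cech_cochains I U F n)"
  have "m (overlap U js) (f js \<otimes>\<^bsub>sections F (overlap U js)\<^esub> g js) =
      m (overlap U js) (f js) \<otimes>\<^bsub>sections G (overlap U js)\<^esub> m (overlap U js) (g js)" if "js \<in> tuples I n" for js
    using hom_mult[OF m_hom[OF openin_overlap[OF cover that]]] fg that
    by (simp add: F.carrier_cech[OF cover])
  then show "cech_map I U n m (f \<otimes>\<^bsub>cech_cochains I U F n\<^esub> g) =
      cech_map I U n m f \<otimes>\<^bsub>cech_cochains I U G n\<^esub> cech_map I U n m g"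
    by (auto simp: cech_map_def cech_cochains_def intro!: restrict_ext)
qed (rule cech_map_closed)

lemma cech_map_coboundary:
  assumes f: "f \<in> carrier (cech_cochains I U F n)"
  shows "cech_map I U (Suc n) m (cech_coboundary I U F n f) = cech_coboundary I U G n (cech_map I U n m f)"
    (is "?l = ?r")
proof (rule extensionalityI)
  show "?l \<in> extensional (tuples I (Suc n))" "?r \<in> extensional (tuples I (Suc n))"
    by (simp_all add: cech_coboundary_def cech_map_def)
  fix ks assume ks: "ks \<in> tuples I (Suc n)"
  let ?V = "overlap U ks"
  note op = openin_overlap[OF cover ks]
  interpret FS: comm_group "sections F ?V" by (rule F.comm[OF op])
  interpret GS: comm_group "sections G ?V" by (rule G.comm[OF op])
  have face: "m ?V (F.face U f ks r) = G.face U (cech_map I U n m f) ks r" if r: "r \<le> Suc n" for r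
  proof -
    note om = omit_tuples[OF ks r]
    have "m ?V (F.face U f ks r) =
        m ?V (res F (overlap U (omit r ks)) ?V (f (omit r ks))) [^]\<^bsub>sections G ?V\<^esub> ((- 1) ^ r :: int)"
      unfolding F.face_def[OF cover]
      using F.res_face_closed[OF cover f ks r]
      by (intro hom_int_pow m_hom op FS.is_group GS.is_group) auto
    also have "m ?V (res F (overlap U (omit r ks)) ?V (f (omit r ks))) =
        res G (overlap U (omit r ks)) ?V (cech_map I U n m f (omit r ks))"
      using f om by (simp add: m_res[OF openin_overlap[OF cover om] op overlap_omit]
          F.carrier_cech[OF cover] cech_map_def)
    finally show ?thesis
      by (simp add: G.face_def[OF cover])
  qed
  have "?l ks = m ?V (finprod (sections F ?V) (F.face U f ks) {..Suc n})"
    using ks by (simp add: cech_map_def F.cech_coboundary_face[OF cover ks])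
  also have "\<dots> = finprod (sections G ?V) (\<lambda>r. m ?V (F.face U f ks r)) {..Suc n}"
    using F.face_closed[OF cover f ks]
    by (intro hom_finprod F.comm G.comm op m_hom) auto
  also have "\<dots> = finprod (sections G ?V) (G.face U (cech_map I U n m f) ks) {..Suc n}"
    using face G.face_closed[OF cover cech_map_closed[OF f] ks]
    by (intro GS.finprod_cong') auto
  also have "\<dots> = ?r ks"
    by (simp add: G.cech_coboundary_face[OF cover ks])
  finally show "?l ks = ?r ks" .
qed

lemma cech_map_inj:
  assumes "\<And>V. openin X V \<Longrightarrow> inj_on (m V) (carrier (sections F V))"
  shows "inj_on (cech_map I U n m) (carrier (cech_cochains I U F n))"
proof (rule inj_onI)
  fix f g assume fg: "f \<in> carrier (cech_cochains I U F n)" "g \<in> carrier (cech_cochains I U F n)"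
    and eq: "cech_map I U n m f = cech_map I U n m g"
  show "f = g"
  proof (rule extensionalityI)
    show "f \<in> extensional (tuples I n)" "g \<in> extensional (tuples I n)"
      using fg by (auto simp: F.carrier_cech[OF cover])
    fix js assume js: "js \<in> tuples I n"
    have "m (overlap U js) (f js) = m (overlap U js) (g js)"
      using fun_cong[OF eq, of js] js by (simp add: cech_map_def)
    then show "f js = g js"
      using assms[OF openin_overlap[OF cover js]] fg js
      by (auto simp: F.carrier_cech[OF cover] dest: inj_onD)
  qed
qed

text \<open>Cochains form a product over tuples, so lifts may be chosen independently on each
  overlap with no gluing condition. Surjectivity on sections is what this asks for, and an image
  presheaf has it by construction.\<close>

lemma cech_map_lift:
  assumes "g \<in> extensional (tuples I n)"
    and "\<And>js. js \<in> tuples I n \<Longrightarrow> g js \<in> m (overlap U js) ` carrier (sections F (overlap U js))"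
  shows "g \<in> cech_map I U n m ` carrier (cech_cochains I U F n)"
proof -
  have "\<exists>f. f \<in> carrier (sections F (overlap U js)) \<and> m (overlap U js) f = g js" if "js \<in> tuples I n" for js
    using assms(2)[OF that] by force
  then obtain f where f: "f js \<in> carrier (sections F (overlap U js))" "m (overlap U js) (f js) = g js"
    if "js \<in> tuples I n" for js
    by metis
  then have "cech_map I U n m (restrict f (tuples I n)) = g"
    using assms(1) by (intro extensionalityI[of _ "tuples I n"]) (auto simp: cech_map_def)
  moreover have "restrict f (tuples I n) \<in> carrier (cech_cochains I U F n)"
    using f by (simp add: F.carrier_cech[OF cover])
  ultimately show ?thesis by blast
qed

lemma cech_map_kernel:
  "f \<in> kernel (cech_cochains I U F n) (cech_cochains I U G n) (cech_map I U n m) \<longleftrightarrow>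
    f \<in> extensional (tuples I n) \<and>
    (\<forall>js\<in>tuples I n. f js \<in> kernel (sections F (overlap U js)) (sections G (overlap U js)) (m (overlap U js)))"
proof -
  have "cech_map I U n m f = \<one>\<^bsub>cech_cochains I U G n\<^esub> \<longleftrightarrow>
      (\<forall>js\<in>tuples I n. m (overlap U js) (f js) = \<one>\<^bsub>sections G (overlap U js)\<^esub>)"
    by (auto simp: cech_map_def cech_cochains_def fun_eq_iff)
  then show ?thesis
    by (auto simp: kernel_def F.carrier_cech[OF cover])
qed

end

end

text \<open>Exactness on every open set passes to products. That the square of the coboundary of
  \<open>G\<close> vanishes enters as \<open>dd\<close>, since it is verified pointwise for
  functions.\<close>

lemma short_exact_cech:
  assumes i: "presheaf_morphism X F G i" and p: "presheaf_morphism X G H p"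
    and inj: "\<And>V. openin X V \<Longrightarrow> inj_on (i V) (carrier (sections F V))"
    and surj: "\<And>V. openin X V \<Longrightarrow> p V ` carrier (sections G V) = carrier (sections H V)"
    and exact: "\<And>V. openin X V \<Longrightarrow> kernel (sections G V) (sections H V) (p V) = i V ` carrier (sections F V)"
    and cover: "open_cover X I U"
    and dd: "\<And>n f. f \<in> carrier (cech_cochains I U G n) \<Longrightarrow>
      cech_coboundary I U G (Suc n) (cech_coboundary I U G n f) = \<one>\<^bsub>cech_cochains I U G (Suc (Suc n))\<^esub>"
  shows "short_exact_cochains (cech_cochains I U F) (cech_coboundary I U F)
    (cech_cochains I U G) (cech_coboundary I U G) (cech_cochains I U H) (cech_coboundary I U H)
    (\<lambda>n. cech_map I U n i) (\<lambda>n. cech_map I U n p)"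
proof -
  interpret i: presheaf_morphism X F G i by fact
  interpret p: presheaf_morphism X G H p by fact
  have "cech_map I U n p ` carrier (cech_cochains I U G n) = carrier (cech_cochains I U H n)" for n
  proof
    show "carrier (cech_cochains I U H n) \<subseteq> cech_map I U n p ` carrier (cech_cochains I U G n)"
    proof
      fix g assume "g \<in> carrier (cech_cochains I U H n)"
      then show "g \<in> cech_map I U n p ` carrier (cech_cochains I U G n)"
        by (intro p.cech_map_lift[OF cover])
          (auto simp: p.G.carrier_cech[OF cover] surj[OF openin_overlap[OF cover]])
    qed
  qed (use p.cech_map_closed[OF cover] in blast)
  moreover have "kernel (cech_cochains I U G n) (cech_cochains I U H n) (cech_map I U n p) =
      cech_map I U n i ` carrier (cech_cochains I U F n)" for n
  proof
    show "kernel (cech_cochains I U G n) (cech_cochains I U H n) (cech_map I U n p) \<subseteq>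
        cech_map I U n i ` carrier (cech_cochains I U F n)"
    proof
      fix g assume "g \<in> kernel (cech_cochains I U G n) (cech_cochains I U H n) (cech_map I U n p)"
      then show "g \<in> cech_map I U n i ` carrier (cech_cochains I U F n)"
        unfolding p.cech_map_kernel[OF cover]
        by (intro i.cech_map_lift[OF cover]) (auto simp: exact[OF openin_overlap[OF cover]])
    qed
    have "i (overlap U js) (f js) \<in> kernel (sections G (overlap U js)) (sections H (overlap U js)) (p (overlap U js))"
      if "f \<in> carrier (cech_cochains I U F n)" "js \<in> tuples I n" for f js
      using that by (auto simp: i.F.carrier_cech[OF cover] exact[OF openin_overlap[OF cover]])
    then show "cech_map I U n i ` carrier (cech_cochains I U F n) \<subseteq>
        kernel (cech_cochains I U G n) (cech_cochains I U H n) (cech_map I U n p)"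
      by (auto simp: p.cech_map_kernel[OF cover]) (simp_all add: cech_map_def)
  qed
  ultimately show ?thesis
    by (intro short_exact_cochains.intro short_exact_cochains_axioms.intro
        i.F.cochain_groups_cech i.G.cochain_groups_cech p.G.cochain_groups_cech cover
        i.cech_map_hom p.cech_map_hom i.cech_map_inj inj dd
        i.cech_map_coboundary p.cech_map_coboundary)
qed

section \<open>The exponential sequence\<close>

lemma tendsto_cong_openin:
  assumes "openin X V" "b \<in> V" "\<And>x. x \<in> V \<Longrightarrow> f x = g x" "(g \<longlongrightarrow> l) (nhdsin X b)"
  shows "(f \<longlongrightarrow> l) (nhdsin X b)"
  using assms(4)
  by (rule Lim_transform_eventually)
    (use eventually_in_openin[OF assms(1,2)] in eventually_elim, simp add: assms(3))

section \<open>Sections of the sheaf of continuous complex functions\<close>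

lemma carrier_cont_C:
  "openin X V \<Longrightarrow> f \<in> carrier (sections (cont_C X) V) \<longleftrightarrow>
    f \<in> extensional V \<and> (\<forall>b\<in>V. (f \<longlongrightarrow> f b) (nhdsin X b))"
  by (simp add: cont_C_def continuous_map_openin_subtopology)

lemma restrict_cont_C:
  assumes "openin X V" "\<And>b. b \<in> V \<Longrightarrow> (f \<longlongrightarrow> f b) (nhdsin X b)"
  shows "restrict f V \<in> carrier (sections (cont_C X) V)"
  using assms by (auto simp: carrier_cont_C intro: tendsto_cong_openin)

lemma mult_cont_C: "f \<otimes>\<^bsub>sections (cont_C X) V\<^esub> g = (\<lambda>x\<in>V. f x + g x)"
  by (simp add: cont_C_def)

lemma one_cont_C: "\<one>\<^bsub>sections (cont_C X) V\<^esub> = (\<lambda>x\<in>V. 0)"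
  by (simp add: cont_C_def)

lemma res_cont_C: "res (cont_C X) V W f = restrict f W"
  by (simp add: cont_C_def)

lemma comm_group_cont_C:
  assumes "openin X V"
  shows "comm_group (sections (cont_C X) V)"
proof (rule comm_groupI)
  fix f g assume "f \<in> carrier (sections (cont_C X) V)" "g \<in> carrier (sections (cont_C X) V)"
  then show "f \<otimes>\<^bsub>sections (cont_C X) V\<^esub> g \<in> carrier (sections (cont_C X) V)"
    unfolding mult_cont_C using assms by (intro restrict_cont_C tendsto_add) (auto simp: carrier_cont_C)
next
  fix f assume f: "f \<in> carrier (sections (cont_C X) V)"
  then have "(\<lambda>x\<in>V. - f x) \<in> carrier (sections (cont_C X) V)"
    using assms by (intro restrict_cont_C tendsto_minus) (auto simp: carrier_cont_C)
  moreover have "(\<lambda>x\<in>V. - f x) \<otimes>\<^bsub>sections (cont_C X) V\<^esub> f = \<one>\<^bsub>sections (cont_C X) V\<^esub>"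
    by (auto simp: mult_cont_C one_cont_C intro!: restrict_ext)
  ultimately show "\<exists>g\<in>carrier (sections (cont_C X) V). g \<otimes>\<^bsub>sections (cont_C X) V\<^esub> f = \<one>\<^bsub>sections (cont_C X) V\<^esub>"
    by blast
  show "\<one>\<^bsub>sections (cont_C X) V\<^esub> \<otimes>\<^bsub>sections (cont_C X) V\<^esub> f = f"
    using f assms
    by (intro extensionalityI[of _ V]) (auto simp: mult_cont_C one_cont_C carrier_cont_C)
next
  show "\<one>\<^bsub>sections (cont_C X) V\<^esub> \<in> carrier (sections (cont_C X) V)"
    unfolding one_cont_C by (rule restrict_cont_C[OF assms]) simp
qed (simp_all add: mult_cont_C ac_simps cong: restrict_cong)

lemma inv_cont_C:
  assumes "openin X V" "f \<in> carrier (sections (cont_C X) V)"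
  shows "inv\<^bsub>sections (cont_C X) V\<^esub> f = (\<lambda>x\<in>V. - f x)"
proof -
  have "(\<lambda>x\<in>V. - f x) \<in> carrier (sections (cont_C X) V)"
    using assms by (intro restrict_cont_C tendsto_minus) (auto simp: carrier_cont_C)
  moreover have "(\<lambda>x\<in>V. - f x) \<otimes>\<^bsub>sections (cont_C X) V\<^esub> f = \<one>\<^bsub>sections (cont_C X) V\<^esub>"
    by (auto simp: mult_cont_C one_cont_C intro!: restrict_ext)
  ultimately show ?thesis
    using assms by (intro group.inv_equality comm_group.axioms(2) comm_group_cont_C)
qed

lemma finprod_cont_C:
  assumes V: "openin X V" and "finite A" "\<And>a. a \<in> A \<Longrightarrow> f a \<in> carrier (sections (cont_C X) V)"
  shows "finprod (sections (cont_C X) V) f A = (\<lambda>x\<in>V. \<Sum>a\<in>A. f a x)"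
proof -
  interpret comm_group "sections (cont_C X) V" by (rule comm_group_cont_C[OF V])
  show ?thesis
    using assms(2,3)
  proof (induction A rule: finite_induct)
    case empty
    show ?case by (simp add: one_cont_C)
  next
    case (insert a A)
    then have "f \<in> A \<rightarrow> carrier (sections (cont_C X) V)" by auto
    then have "finprod (sections (cont_C X) V) f (insert a A) =
        f a \<otimes>\<^bsub>sections (cont_C X) V\<^esub> finprod (sections (cont_C X) V) f A"
      using insert by (intro finprod_insert) auto
    also have "finprod (sections (cont_C X) V) f A = (\<lambda>x\<in>V. \<Sum>a\<in>A. f a x)"
      using insert by auto
    finally show ?case
      using insert.hyps by (auto simp: mult_cont_C intro!: restrict_ext)
  qed
qed

lemma abelian_presheaf_cont_C: "abelian_presheaf X (cont_C X)"
proof (rule abelian_presheaf.intro)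
  fix V W assume V: "openin X V" and W: "openin X W" "W \<subseteq> V"
  show "res (cont_C X) V W \<in> hom (sections (cont_C X) V) (sections (cont_C X) W)"
  proof (rule homI)
    fix f assume "f \<in> carrier (sections (cont_C X) V)"
    then show "res (cont_C X) V W f \<in> carrier (sections (cont_C X) W)"
      unfolding res_cont_C using V W by (intro restrict_cont_C) (auto simp: carrier_cont_C)
  qed (use W in \<open>auto simp: res_cont_C mult_cont_C Int_absorb1 intro!: restrict_ext\<close>)
qed (rule comm_group_cont_C)

section \<open>Sections of the sheaf of locally constant integer functions\<close>

lemma carrier_const_Z:
  assumes "openin X V"
  shows "f \<in> carrier (sections (const_Z X) V) \<longleftrightarrow>
    f \<in> extensional V \<and> (\<forall>b\<in>V. eventually (\<lambda>x. f x = f b) (nhdsin X b))"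
proof -
  have "eventually (\<lambda>x. f x = f b) (nhdsin X b) \<longleftrightarrow>
      (\<exists>W. openin X W \<and> b \<in> W \<and> W \<subseteq> V \<and> (\<forall>x\<in>W. f x = f b))" (is "?L \<longleftrightarrow> ?R") if b: "b \<in> V" for b
  proof
    assume ?L
    moreover have "b \<in> topspace X"
      using b openin_subset[OF assms] by blast
    ultimately obtain W where "openin X W" "b \<in> W" "\<forall>x\<in>W. f x = f b"
      unfolding eventually_nhdsin by blast
    then show ?R
      using b assms by (intro exI[of _ "W \<inter> V"] conjI openin_Int) blast+
  qed (unfold eventually_nhdsin, blast)
  then show ?thesis
    by (simp add: const_Z_def)
qed

lemma restrict_const_Z:
  assumes V: "openin X V" and "\<And>b. b \<in> V \<Longrightarrow> eventually (\<lambda>x. f x = f b) (nhdsin X b)"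
  shows "restrict f V \<in> carrier (sections (const_Z X) V)"
  unfolding carrier_const_Z[OF V]
proof (intro conjI ballI)
  fix b assume b: "b \<in> V"
  from assms(2)[OF b] eventually_in_openin[OF V b]
  show "eventually (\<lambda>x. restrict f V x = restrict f V b) (nhdsin X b)"
    by eventually_elim (use b in auto)
qed simp

lemma mult_const_Z: "f \<otimes>\<^bsub>sections (const_Z X) V\<^esub> g = (\<lambda>x\<in>V. f x + g x)"
  by (simp add: const_Z_def)

lemma one_const_Z: "\<one>\<^bsub>sections (const_Z X) V\<^esub> = (\<lambda>x\<in>V. 0)"
  by (simp add: const_Z_def)

lemma res_const_Z: "res (const_Z X) V W f = restrict f W"
  by (simp add: const_Z_def)

lemma comm_group_const_Z:
  assumes V: "openin X V"
  shows "comm_group (sections (const_Z X) V)"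
proof (rule comm_groupI)
  fix f g assume fg: "f \<in> carrier (sections (const_Z X) V)" "g \<in> carrier (sections (const_Z X) V)"
  show "f \<otimes>\<^bsub>sections (const_Z X) V\<^esub> g \<in> carrier (sections (const_Z X) V)"
    unfolding mult_const_Z
  proof (rule restrict_const_Z[OF V])
    fix b assume "b \<in> V"
    then have "eventually (\<lambda>x. f x = f b) (nhdsin X b)" "eventually (\<lambda>x. g x = g b) (nhdsin X b)"
      using fg by (simp_all add: carrier_const_Z[OF V])
    then show "eventually (\<lambda>x. f x + g x = f b + g b) (nhdsin X b)"
      by eventually_elim simp
  qed
next
  fix f assume f: "f \<in> carrier (sections (const_Z X) V)"
  then have "(\<lambda>x\<in>V. - f x) \<in> carrier (sections (const_Z X) V)"
    using V by (intro restrict_const_Z) (auto simp: carrier_const_Z)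
  moreover have "(\<lambda>x\<in>V. - f x) \<otimes>\<^bsub>sections (const_Z X) V\<^esub> f = \<one>\<^bsub>sections (const_Z X) V\<^esub>"
    by (auto simp: mult_const_Z one_const_Z intro!: restrict_ext)
  ultimately show "\<exists>g\<in>carrier (sections (const_Z X) V). g \<otimes>\<^bsub>sections (const_Z X) V\<^esub> f = \<one>\<^bsub>sections (const_Z X) V\<^esub>"
    by blast
  show "\<one>\<^bsub>sections (const_Z X) V\<^esub> \<otimes>\<^bsub>sections (const_Z X) V\<^esub> f = f"
    using f V
    by (intro extensionalityI[of _ V]) (auto simp: mult_const_Z one_const_Z carrier_const_Z)
next
  show "\<one>\<^bsub>sections (const_Z X) V\<^esub> \<in> carrier (sections (const_Z X) V)"
    unfolding one_const_Z by (rule restrict_const_Z[OF V]) simp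
qed (simp_all add: mult_const_Z ac_simps cong: restrict_cong)

lemma abelian_presheaf_const_Z: "abelian_presheaf X (const_Z X)"
proof (rule abelian_presheaf.intro)
  fix V W assume V: "openin X V" and W: "openin X W" "W \<subseteq> V"
  show "res (const_Z X) V W \<in> hom (sections (const_Z X) V) (sections (const_Z X) W)"
  proof (rule homI)
    fix f assume "f \<in> carrier (sections (const_Z X) V)"
    then show "res (const_Z X) V W f \<in> carrier (sections (const_Z X) W)"
      unfolding res_const_Z using V W by (intro restrict_const_Z) (auto simp: carrier_const_Z)
  qed (use W in \<open>auto simp: res_const_Z mult_const_Z Int_absorb1 intro!: restrict_ext\<close>)
qed (rule comm_group_const_Z)

section \<open>The image presheaf of the exponential and exactness\<close>

lemma carrier_Im_exp: "carrier (sections (Im_exp X) V) = exp_map V ` carrier (sections (cont_C X) V)"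
  by (simp add: Im_exp_def image_presheaf_def)

lemma mult_Im_exp: "f \<otimes>\<^bsub>sections (Im_exp X) V\<^esub> g = (\<lambda>x\<in>V. f x * g x)"
  by (simp add: Im_exp_def image_presheaf_def cont_C_units_def)

lemma one_Im_exp: "\<one>\<^bsub>sections (Im_exp X) V\<^esub> = (\<lambda>x\<in>V. 1)"
  by (simp add: Im_exp_def image_presheaf_def cont_C_units_def)

lemma res_Im_exp: "res (Im_exp X) V W f = restrict f W"
  by (simp add: Im_exp_def image_presheaf_def cont_C_units_def)

lemma exp_map_add:
  "exp_map V (f \<otimes>\<^bsub>sections (cont_C X) V\<^esub> g) = exp_map V f \<otimes>\<^bsub>sections (Im_exp X) V\<^esub> exp_map V g"
  by (auto simp: exp_map_def mult_cont_C mult_Im_exp exp_add[symmetric] algebra_simps intro!: restrict_ext)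

lemma exp_map_zero: "exp_map V \<one>\<^bsub>sections (cont_C X) V\<^esub> = \<one>\<^bsub>sections (Im_exp X) V\<^esub>"
  by (auto simp: exp_map_def one_cont_C one_Im_exp intro!: restrict_ext)

lemma exp_map_hom: "exp_map V \<in> hom (sections (cont_C X) V) (sections (Im_exp X) V)"
  by (rule homI) (auto simp: carrier_Im_exp exp_map_add)

text \<open>The group laws are read off along \<open>exp_map V\<close>: every element is an
  exponential, and the exponential of the negated lift is its inverse.\<close>

lemma comm_group_Im_exp:
  assumes V: "openin X V"
  shows "comm_group (sections (Im_exp X) V)"
proof (rule comm_groupI)
  interpret C: comm_group "sections (cont_C X) V" by (rule comm_group_cont_C[OF V])
  show "f \<otimes>\<^bsub>sections (Im_exp X) V\<^esub> g \<in> carrier (sections (Im_exp X) V)"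
    if "f \<in> carrier (sections (Im_exp X) V)" "g \<in> carrier (sections (Im_exp X) V)" for f g
    using that by (auto simp: carrier_Im_exp exp_map_add[symmetric])
  show "\<one>\<^bsub>sections (Im_exp X) V\<^esub> \<in> carrier (sections (Im_exp X) V)"
    by (auto simp: carrier_Im_exp exp_map_zero[symmetric])
  fix f assume "f \<in> carrier (sections (Im_exp X) V)"
  then obtain h where h: "h \<in> carrier (sections (cont_C X) V)" "f = exp_map V h"
    by (auto simp: carrier_Im_exp)
  show "\<one>\<^bsub>sections (Im_exp X) V\<^esub> \<otimes>\<^bsub>sections (Im_exp X) V\<^esub> f = f"
    using h by (simp add: exp_map_zero[symmetric] exp_map_add[symmetric])
  have "exp_map V (inv\<^bsub>sections (cont_C X) V\<^esub> h) \<otimes>\<^bsub>sections (Im_exp X) V\<^esub> f = \<one>\<^bsub>sections (Im_exp X) V\<^esub>"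
    using h by (simp add: exp_map_zero[symmetric] exp_map_add[symmetric])
  then show "\<exists>g\<in>carrier (sections (Im_exp X) V). g \<otimes>\<^bsub>sections (Im_exp X) V\<^esub> f = \<one>\<^bsub>sections (Im_exp X) V\<^esub>"
    using h by (auto simp: carrier_Im_exp)
qed (simp_all add: mult_Im_exp ac_simps cong: restrict_cong)

lemma restrict_exp_map: "W \<subseteq> V \<Longrightarrow> restrict (exp_map V f) W = exp_map W (restrict f W)"
  by (auto simp: exp_map_def Int_absorb1 intro!: restrict_ext)

lemma abelian_presheaf_Im_exp: "abelian_presheaf X (Im_exp X)"
proof (rule abelian_presheaf.intro)
  fix V W assume V: "openin X V" and W: "openin X W" "W \<subseteq> V"
  show "res (Im_exp X) V W \<in> hom (sections (Im_exp X) V) (sections (Im_exp X) W)"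
  proof (rule homI)
    fix f assume "f \<in> carrier (sections (Im_exp X) V)"
    then show "res (Im_exp X) V W f \<in> carrier (sections (Im_exp X) W)"
      using hom_in_carrier[OF abelian_presheaf.res_hom[OF abelian_presheaf_cont_C V W]]
      by (auto simp: carrier_Im_exp res_Im_exp restrict_exp_map[OF W(2)] res_cont_C)
  qed (use W in \<open>auto simp: res_Im_exp mult_Im_exp Int_absorb1 intro!: restrict_ext\<close>)
qed (rule comm_group_Im_exp)

lemma exp_morphism: "presheaf_morphism X (cont_C X) (Im_exp X) exp_map"
  by (intro presheaf_morphism.intro presheaf_morphism_axioms.intro
      abelian_presheaf_cont_C abelian_presheaf_Im_exp exp_map_hom)
    (simp add: res_cont_C res_Im_exp restrict_exp_map)

lemma incl_Z_closed:
  assumes V: "openin X V" and f: "f \<in> carrier (sections (const_Z X) V)"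
  shows "incl_Z V f \<in> carrier (sections (cont_C X) V)"
  unfolding incl_Z_def
proof (rule restrict_cont_C[OF V])
  fix b assume "b \<in> V"
  then have "eventually (\<lambda>x. f x = f b) (nhdsin X b)"
    using f V by (simp add: carrier_const_Z)
  then have "eventually (\<lambda>x. (of_int (f b) :: complex) = of_int (f x)) (nhdsin X b)"
    by eventually_elim simp
  then show "((\<lambda>x. of_int (f x) :: complex) \<longlongrightarrow> of_int (f b)) (nhdsin X b)"
    by (rule Lim_transform_eventually[OF tendsto_const])
qed

lemma incl_morphism: "presheaf_morphism X (const_Z X) (cont_C X) incl_Z"
proof (intro presheaf_morphism.intro presheaf_morphism_axioms.intro
    abelian_presheaf_cont_C abelian_presheaf_const_Z)
  show "incl_Z V \<in> hom (sections (const_Z X) V) (sections (cont_C X) V)" if "openin X V" for V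
    using that
    by (intro homI incl_Z_closed) (auto simp: mult_const_Z mult_cont_C incl_Z_def intro!: restrict_ext)
qed (auto simp: incl_Z_def res_const_Z res_cont_C Int_absorb1 intro!: restrict_ext)

lemma incl_Z_inj:
  assumes "openin X V"
  shows "inj_on (incl_Z V) (carrier (sections (const_Z X) V))"
proof (rule inj_onI)
  fix f g assume "f \<in> carrier (sections (const_Z X) V)" "g \<in> carrier (sections (const_Z X) V)"
    and eq: "incl_Z V f = incl_Z V g"
  then have "f \<in> extensional V" "g \<in> extensional V"
    using assms by (auto simp: carrier_const_Z)
  moreover have "f x = g x" if "x \<in> V" for x
    using fun_cong[OF eq, of x] that by (simp add: incl_Z_def)
  ultimately show "f = g" by (rule extensionalityI)
qed

lemma exp_2pii_eq_1_iff: "exp (2 * of_real pi * \<i> * z) = 1 \<longleftrightarrow> z \<in> \<int>"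
proof -
  have "Im z = 0 \<and> (\<exists>n::int. Re z = of_int n) \<longleftrightarrow> z \<in> \<int>"
    by (auto simp: Ints_def complex_eq_iff)
  then show ?thesis
    by (simp add: exp_eq_1)
qed

lemma kernel_exp_map:
  assumes V: "openin X V"
  shows "kernel (sections (cont_C X) V) (sections (Im_exp X) V) (exp_map V) =
    incl_Z V ` carrier (sections (const_Z X) V)" (is "?K = ?I")
proof
  show "?I \<subseteq> ?K"
    using incl_Z_closed[OF V]
    by (auto simp: kernel_def one_Im_exp exp_map_def incl_Z_def exp_2pii_eq_1_iff intro!: restrict_ext)
  show "?K \<subseteq> ?I"
  proof
    fix f assume f: "f \<in> ?K"
    then have fC: "f \<in> carrier (sections (cont_C X) V)" and f1: "exp_map V f = (\<lambda>x\<in>V. 1)"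
      by (auto simp: kernel_def one_Im_exp)
    have int: "f x \<in> \<int>" if "x \<in> V" for x
      using fun_cong[OF f1, of x] that by (simp add: exp_map_def exp_2pii_eq_1_iff)
    define n where "n x = \<lfloor>Re (f x)\<rfloor>" for x
    have n: "f x = of_int (n x)" if "x \<in> V" for x
      using int[OF that] by (auto simp: n_def elim!: Ints_cases)
    have "restrict n V \<in> carrier (sections (const_Z X) V)"
    proof (rule restrict_const_Z[OF V])
      fix b assume b: "b \<in> V"
      then have "(f \<longlongrightarrow> f b) (nhdsin X b)"
        using fC V by (simp add: carrier_cont_C)
      \<comment> \<open>The values on \<open>V\<close> are integers, so a distance below 1 forces
        equality; continuity thus becomes local constancy.\<close>
      then have "eventually (\<lambda>x. dist (f x) (f b) < 1) (nhdsin X b)"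
        by (rule tendstoD) simp
      from this eventually_in_openin[OF V b] show "eventually (\<lambda>x. n x = n b) (nhdsin X b)"
      proof eventually_elim
        case (elim x)
        then have "norm (of_int (n x - n b) :: complex) < 1"
          using b by (simp add: n dist_norm)
        then show ?case
          unfolding norm_of_int by linarith
      qed
    qed
    moreover have "incl_Z V (restrict n V) = f"
      using fC V n by (intro extensionalityI[of _ V]) (auto simp: incl_Z_def carrier_cont_C)
    ultimately show "f \<in> ?I" by blast
  qed
qed

text \<open>Near \<open>b\<close> the infinite sum is one fixed finite sum. Convergence is asked
  only of the indices in \<open>F\<close>; the other terms vanish there.\<close>

lemma locally_finite_sum_tendsto:
  fixes f :: "'i \<Rightarrow> 'a \<Rightarrow> 'b::real_normed_vector"
  assumes F: "finite F" "F \<subseteq> I" "eventually (\<lambda>x. \<forall>t\<in>I - F. f t x = 0) (nhdsin X b)"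
    and f: "\<And>t. t \<in> F \<Longrightarrow> (f t \<longlongrightarrow> f t b) (nhdsin X b)" and b: "b \<in> topspace X"
  shows "((\<lambda>x. \<Sum>\<^sub>\<infinity>t\<in>I. f t x) \<longlongrightarrow> (\<Sum>\<^sub>\<infinity>t\<in>I. f t b)) (nhdsin X b)"
proof -
  have eq: "(\<Sum>\<^sub>\<infinity>t\<in>I. f t x) = (\<Sum>t\<in>F. f t x)" if "\<forall>t\<in>I - F. f t x = 0" for x
  proof -
    have "(\<Sum>\<^sub>\<infinity>t\<in>I. f t x) = infsum (\<lambda>t. f t x) F"
      using that F by (intro infsum_cong_neutral) auto
    then show ?thesis using F by simp
  qed
  have "((\<lambda>x. \<Sum>t\<in>F. f t x) \<longlongrightarrow> (\<Sum>t\<in>F. f t b)) (nhdsin X b)"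
    by (intro tendsto_sum f)
  moreover have "eventually (\<lambda>x. (\<Sum>t\<in>F. f t x) = (\<Sum>\<^sub>\<infinity>t\<in>I. f t x)) (nhdsin X b)"
    using F(3) by eventually_elim (simp add: eq)
  ultimately show ?thesis
    using eq[OF eventually_nhdsin_self[OF F(3) b]] by (simp add: Lim_transform_eventually)
qed

section \<open>Pointwise coboundaries and acyclicity of the continuous functions\<close>

context
  fixes X :: "'a topology" and I :: "'i set" and U :: "'i \<Rightarrow> 'a set"
  assumes cover: "open_cover X I U"
begin

lemmas carrier_cech_C = abelian_presheaf.carrier_cech[OF abelian_presheaf_cont_C cover]

lemma cochain_C_tendsto:
  "f \<in> carrier (cech_cochains I U (cont_C X) n) \<Longrightarrow> js \<in> tuples I n \<Longrightarrow> b \<in> overlap U js \<Longrightarrow>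
    (f js \<longlongrightarrow> f js b) (nhdsin X b)"
  using carrier_cont_C[OF openin_overlap[OF cover]] by (auto simp: carrier_cech_C)

lemma cochain_C_ext:
  assumes "f \<in> carrier (cech_cochains I U (cont_C X) n)" "g \<in> carrier (cech_cochains I U (cont_C X) n)"
    and "\<And>js b. js \<in> tuples I n \<Longrightarrow> b \<in> overlap U js \<Longrightarrow> f js b = g js b"
  shows "f = g"
proof (rule extensionalityI)
  show "f \<in> extensional (tuples I n)" "g \<in> extensional (tuples I n)"
    using assms by (auto simp: carrier_cech_C)
  fix js assume js: "js \<in> tuples I n"
  then have "f js \<in> extensional (overlap U js)" "g js \<in> extensional (overlap U js)"
    using assms carrier_cont_C[OF openin_overlap[OF cover]] by (auto simp: carrier_cech_C)
  then show "f js = g js"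
    using assms(3)[OF js] by (rule extensionalityI)
qed

lemma coboundary_cont_C:
  assumes f: "f \<in> carrier (cech_cochains I U (cont_C X) n)"
    and ks: "ks \<in> tuples I (Suc n)" and b: "b \<in> overlap U ks"
  shows "cech_coboundary I U (cont_C X) n f ks b = face_sum (\<lambda>js. f js b) ks"
proof -
  interpret abelian_presheaf X "cont_C X" by (rule abelian_presheaf_cont_C)
  let ?S = "sections (cont_C X) (overlap U ks)"
  note op = openin_overlap[OF cover ks]
  interpret S: comm_group ?S by (rule comm[OF op])
  have face: "face U f ks r b = (- 1) ^ r * f (omit r ks) b" if r: "r \<le> Suc n" for r
  proof -
    let ?g = "res (cont_C X) (overlap U (omit r ks)) (overlap U ks) (f (omit r ks))"
    have g: "?g \<in> carrier ?S"
      by (rule res_face_closed[OF cover f ks r])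
    have gb: "?g b = f (omit r ks) b"
      using b by (simp add: res_cont_C)
    \<comment> \<open>The sign is an integer power in the multiplicatively written group of
      sections: the exponent is 1 or -1 according to parity.\<close>
    show ?thesis
    proof (cases "even r")
      case True
      then show ?thesis
        using g gb by (simp add: face_def[OF cover])
    next
      case False
      then show ?thesis
        using g gb b by (simp add: face_def[OF cover] S.int_pow_neg inv_cont_C[OF op])
    qed
  qed
  have "cech_coboundary I U (cont_C X) n f ks b = (\<Sum>r\<le>Suc n. face U f ks r b)"
    using b by (subst cech_coboundary_face[OF cover ks], subst finprod_cont_C[OF op])
      (auto intro: face_closed[OF cover f ks])
  also have "\<dots> = (\<Sum>r\<le>Suc n. (- 1) ^ r * f (omit r ks) b)"
    by (intro sum.cong) (auto simp: face)
  also have "\<dots> = face_sum (\<lambda>js. f js b) ks"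
    using ks by (simp add: face_sum_def tuples_def lessThan_Suc_atMost)
  finally show ?thesis .
qed

lemma one_cech_C: "js \<in> tuples I n \<Longrightarrow> b \<in> overlap U js \<Longrightarrow> \<one>\<^bsub>cech_cochains I U (cont_C X) n\<^esub> js b = 0"
  by (simp add: cech_cochains_def one_cont_C)

lemma coboundary_coboundary_cont_C:
  assumes f: "f \<in> carrier (cech_cochains I U (cont_C X) n)"
  shows "cech_coboundary I U (cont_C X) (Suc n) (cech_coboundary I U (cont_C X) n f) =
    \<one>\<^bsub>cech_cochains I U (cont_C X) (Suc (Suc n))\<^esub>"
proof -
  interpret abelian_presheaf X "cont_C X" by (rule abelian_presheaf_cont_C)
  note df = cech_coboundary_closed[OF cover f]
  show ?thesis
  proof (rule cochain_C_ext)
    show "\<one>\<^bsub>cech_cochains I U (cont_C X) (Suc (Suc n))\<^esub> \<in> carrier (cech_cochains I U (cont_C X) (Suc (Suc n)))"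
      by (intro monoid.one_closed group.is_monoid comm_group.axioms comm_group_cech cover)
    fix ks b assume ks: "ks \<in> tuples I (Suc (Suc n))" and b: "b \<in> overlap U ks"
    have "cech_coboundary I U (cont_C X) n f (omit j ks) b = face_sum (\<lambda>js. f js b) (omit j ks)"
      if "j < length ks" for j
      using that ks b overlap_omit[of U ks j] omit_tuples[OF ks, of j]
      by (intro coboundary_cont_C[OF f]) (auto simp: tuples_def)
    then have "cech_coboundary I U (cont_C X) (Suc n) (cech_coboundary I U (cont_C X) n f) ks b =
        face_sum (face_sum (\<lambda>js. f js b)) ks"
      using coboundary_cont_C[OF df ks b] face_sum_cong by metis
    then show "cech_coboundary I U (cont_C X) (Suc n) (cech_coboundary I U (cont_C X) n f) ks b =
        \<one>\<^bsub>cech_cochains I U (cont_C X) (Suc (Suc n))\<^esub> ks b"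
      using ks b by (simp add: face_sum_face_sum one_cech_C)
  qed (rule cech_coboundary_closed[OF cover df])
qed

text \<open>
  A partition of unity \<open>\<rho>\<close> subordinate to \<open>U\<close> gives the contracting homotopy
  \<open>(h f)\<^sub>j\<^sub>s = \<Sum>t. \<rho>\<^sub>t f\<^sub>t\<^sub>#\<^sub>j\<^sub>s\<close>.
\<close>
lemma cont_C_acyclic:
  assumes part: "dominated_partition_of_unity X I U \<phi>"
  shows "cocycles (cech_cochains I U (cont_C X)) (cech_coboundary I U (cont_C X)) (Suc n) \<subseteq>
    coboundaries (cech_cochains I U (cont_C X)) (cech_coboundary I U (cont_C X)) (Suc n)"
proof
  interpret abelian_presheaf X "cont_C X" by (rule abelian_presheaf_cont_C)
  fix f assume "f \<in> cocycles (cech_cochains I U (cont_C X)) (cech_coboundary I U (cont_C X)) (Suc n)"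
  then have f: "f \<in> carrier (cech_cochains I U (cont_C X) (Suc n))"
    and df: "cech_coboundary I U (cont_C X) (Suc n) f = \<one>\<^bsub>cech_cochains I U (cont_C X) (Suc (Suc n))\<^esub>"
    by (auto simp: cocycles_def kernel_def)
  obtain \<rho> :: "'i \<Rightarrow> 'a \<Rightarrow> real"
    where \<rho>_tendsto: "\<And>t b. t \<in> I \<Longrightarrow> b \<in> topspace X \<Longrightarrow> (\<rho> t \<longlongrightarrow> \<rho> t b) (nhdsin X b)"
    and \<rho>_supp: "\<And>t b. t \<in> I \<Longrightarrow> b \<in> topspace X - U t \<Longrightarrow> eventually (\<lambda>x. \<rho> t x = 0) (nhdsin X b)"
    and \<rho>_lf: "\<And>b. b \<in> topspace X \<Longrightarrow>
      \<exists>F. finite F \<and> F \<subseteq> I \<and> eventually (\<lambda>x. \<forall>t\<in>I - F. \<rho> t x = 0) (nhdsin X b)"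
    and \<rho>_sum: "\<And>b F. b \<in> topspace X \<Longrightarrow> finite F \<Longrightarrow> F \<subseteq> I \<Longrightarrow> (\<forall>t\<in>I - F. \<rho> t b = 0) \<Longrightarrow> (\<Sum>t\<in>F. \<rho> t b) = 1"
    using locally_finite_partition_subordinate[OF cover part] by blast
  \<comment> \<open>For \<open>x\<close> in \<open>overlap U js\<close> but outside
    \<open>U t\<close>, \<open>f (t # js) x\<close> is only the default value of an extensional
    function; the factor \<open>\<rho> t x\<close> is 0 there.\<close>
  define v where "v js x = (\<Sum>\<^sub>\<infinity>t\<in>I. of_real (\<rho> t x) * f (t # js) x)" for js x
  define h where "h = (\<lambda>js\<in>tuples I n. restrict (v js) (overlap U js))"
  have h: "h \<in> carrier (cech_cochains I U (cont_C X) n)"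
    unfolding carrier_cech[OF cover]
  proof (intro conjI ballI)
    fix js assume js: "js \<in> tuples I n"
    have "restrict (v js) (overlap U js) \<in> carrier (sections (cont_C X) (overlap U js))"
    proof (rule restrict_cont_C[OF openin_overlap[OF cover js]])
      fix b assume b: "b \<in> overlap U js"
      then have bX: "b \<in> topspace X"
        using openin_subset[OF openin_overlap[OF cover js]] by blast
      obtain F where F: "finite F" "F \<subseteq> I" "eventually (\<lambda>x. \<forall>t\<in>I - F. \<rho> t x = 0) (nhdsin X b)"
        using \<rho>_lf[OF bX] by blast
      show "(v js \<longlongrightarrow> v js b) (nhdsin X b)"
        unfolding v_def
      proof (rule locally_finite_sum_tendsto[OF F(1,2) _ _ bX])
        show "eventually (\<lambda>x. \<forall>t\<in>I - F. of_real (\<rho> t x) * f (t # js) x = 0) (nhdsin X b)"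
          using F(3) by eventually_elim simp
        fix t assume "t \<in> F"
        then have t: "t \<in> I" using F by blast
        show "((\<lambda>x. of_real (\<rho> t x) * f (t # js) x) \<longlongrightarrow> of_real (\<rho> t b) * f (t # js) b) (nhdsin X b)"
        proof (cases "b \<in> U t")
          case True
          then have "(f (t # js) \<longlongrightarrow> f (t # js) b) (nhdsin X b)"
            using t js b by (intro cochain_C_tendsto[OF f]) (auto simp: tuples_def overlap_Cons)
          then show ?thesis
            using \<rho>_tendsto[OF t bX] by (intro tendsto_mult tendsto_of_real)
        next
          case False
          \<comment> \<open>Vanishing of \<open>\<rho> t\<close> near \<open>b\<close> makes the
            product locally 0, whatever \<open>f (t # js)\<close> does at the boundary of
            \<open>U t\<close>.\<close>
          then have ev: "eventually (\<lambda>x. \<rho> t x = 0) (nhdsin X b)"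
            using \<rho>_supp t bX by blast
          from ev have "eventually (\<lambda>x. 0 = of_real (\<rho> t x) * f (t # js) x) (nhdsin X b)"
            by eventually_elim simp
          then have "((\<lambda>x. of_real (\<rho> t x) * f (t # js) x) \<longlongrightarrow> 0) (nhdsin X b)"
            by (rule Lim_transform_eventually[OF tendsto_const])
          then show ?thesis
            using eventually_nhdsin_self[OF ev bX] by simp
        qed
      qed
    qed
    then show "h js \<in> carrier (sections (cont_C X) (overlap U js))"
      using js by (simp add: h_def)
  qed (simp add: h_def)
  have "cech_coboundary I U (cont_C X) n h = f"
  proof (rule cochain_C_ext[OF cech_coboundary_closed[OF cover h] f])
    fix ks b assume ks: "ks \<in> tuples I (Suc n)" and b: "b \<in> overlap U ks"
    then have bX: "b \<in> topspace X"
      using openin_subset[OF openin_overlap[OF cover ks]] by blast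
    obtain F where F: "finite F" "F \<subseteq> I" "eventually (\<lambda>x. \<forall>t\<in>I - F. \<rho> t x = 0) (nhdsin X b)"
      using \<rho>_lf[OF bX] by blast
    note F3 = eventually_nhdsin_self[OF F(3) bX]
    have v: "v js b = (\<Sum>t\<in>F. of_real (\<rho> t b) * f (t # js) b)" for js
    proof -
      have "v js b = infsum (\<lambda>t. of_real (\<rho> t b) * f (t # js) b) F"
        unfolding v_def using F F3 by (intro infsum_cong_neutral) auto
      then show ?thesis using F by simp
    qed
    have "cech_coboundary I U (cont_C X) n h ks b = face_sum (\<lambda>js. h js b) ks"
      by (rule coboundary_cont_C[OF h ks b])
    also have "\<dots> = face_sum (\<lambda>js. v js b) ks"
      using ks b overlap_omit[of U ks] omit_tuples[OF ks]
      by (intro face_sum_cong) (auto simp: h_def tuples_def)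
    also have "\<dots> = (\<Sum>t\<in>F. of_real (\<rho> t b) * face_sum (\<lambda>js. f (t # js) b) ks)"
      unfolding v by (rule face_sum_sum)
    also have "\<dots> = (\<Sum>t\<in>F. of_real (\<rho> t b) * f ks b)"
    proof (intro sum.cong refl)
      fix t assume "t \<in> F"
      then have t: "t \<in> I" using F by blast
      show "of_real (\<rho> t b) * face_sum (\<lambda>js. f (t # js) b) ks = of_real (\<rho> t b) * f ks b"
      proof (cases "\<rho> t b = 0")
        case False
        then have "b \<in> U t"
          using eventually_nhdsin_self[OF \<rho>_supp[OF t] bX] bX by blast
        then have tks: "t # ks \<in> tuples I (Suc (Suc n))" "b \<in> overlap U (t # ks)"
          using t ks b by (auto simp: tuples_def overlap_Cons)
        \<comment> \<open>The cocycle identity on \<open>t # ks\<close> at \<open>b\<close>: its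
          first face is \<open>f ks b\<close>, so the alternating sum over the faces that start with
          \<open>t\<close> equals this value.\<close>
        have "face_sum (\<lambda>js. f js b) (t # ks) = 0"
          using coboundary_cont_C[OF f tks] one_cech_C[OF tks] df by simp
        then show ?thesis
          by (simp add: face_sum_Cons)
      qed simp
    qed
    also have "\<dots> = of_real (\<Sum>t\<in>F. \<rho> t b) * f ks b"
      by (simp add: sum_distrib_right)
    also have "\<dots> = f ks b"
      using \<rho>_sum[OF bX F(1,2) F3] by simp
    finally show "cech_coboundary I U (cont_C X) n h ks b = f ks b" .
  qed
  then show "f \<in> coboundaries (cech_cochains I U (cont_C X)) (cech_coboundary I U (cont_C X)) (Suc n)"
    using h by auto
qed

end

lemma exponential_sequence:
  assumes "open_cover X I U"
  shows "short_exact_cochains (cech_cochains I U (const_Z X)) (cech_coboundary I U (const_Z X))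
    (cech_cochains I U (cont_C X)) (cech_coboundary I U (cont_C X))
    (cech_cochains I U (Im_exp X)) (cech_coboundary I U (Im_exp X))
    (\<lambda>n. cech_map I U n incl_Z) (\<lambda>n. cech_map I U n exp_map)"
  by (rule short_exact_cech[OF incl_morphism exp_morphism incl_Z_inj _ kernel_exp_map assms])
    (simp_all add: carrier_Im_exp coboundary_coboundary_cont_C[OF assms])

lemma Delta_eq_connect:
  assumes "open_cover X I U"
  shows "Delta X I U = short_exact_cochains.connect
    (cech_cochains I U (const_Z X)) (cech_coboundary I U (const_Z X))
    (cech_cochains I U (cont_C X)) (cech_coboundary I U (cont_C X))
    (\<lambda>n. cech_map I U n incl_Z) (\<lambda>n. cech_map I U n exp_map) 1"
  by (intro ext)
    (simp add: Delta_def connecting_def short_exact_cochains.connect_def[OF exponential_sequence[OF assms]])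

section \<open>Alternating functions\<close>

text \<open>Antisymmetry under adjacent swaps, quantified over prefix and suffix: it survives
  prepending an entry, which list induction needs, and adjacent swaps generate all
  permutations.\<close>

definition alternating :: "('i list \<Rightarrow> int) \<Rightarrow> bool" where
  "alternating f \<longleftrightarrow> (\<forall>p a b q. f (p @ a # b # q) = - f (p @ b # a # q))"

lemma alternatingD: "alternating f \<Longrightarrow> f (p @ a # b # q) = - f (p @ b # a # q)"
  unfolding alternating_def by blast

lemma alternating_Cons:
  assumes "alternating f"
  shows "alternating (\<lambda>l. f (a # l))"
proof -
  have "f (a # p @ x # y # q) = - f (a # p @ y # x # q)" for p x y q
    using alternatingD[OF assms, of "a # p" x y q] by simp
  then show ?thesis
    unfolding alternating_def by blast
qed

lemma alternating_diff:
  assumes "alternating f" "alternating g"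
  shows "alternating (\<lambda>l. f l - g l)"
proof -
  have "f (p @ a # b # q) - g (p @ a # b # q) = - (f (p @ b # a # q) - g (p @ b # a # q))" for p a b q
    using alternatingD[OF assms(1), of p a b q] alternatingD[OF assms(2), of p a b q] by linarith
  then show ?thesis
    unfolding alternating_def by blast
qed

text \<open>Adjacent swaps bring the equal entries together, where f = - f forces 0 in the
  integers.\<close>

lemma alternating_repeat:
  assumes "alternating f"
  shows "f (p @ a # q @ a # r) = 0"
proof (induction q arbitrary: p)
  case Nil
  then show ?case
    using alternatingD[OF assms, of p a a r] by simp
next
  case (Cons c q)
  then show ?case
    using alternatingD[OF assms, of p a c "q @ a # r"] Cons[of "p @ [c]"] by simp
qed

lemma alternating_not_distinct: "alternating f \<Longrightarrow> \<not> distinct ks \<Longrightarrow> f ks = 0"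
  by (metis alternating_repeat not_distinct_decomp append.assoc append_Cons append_Nil)

text \<open>Insertion is a sequence of adjacent swaps. Only vanishing is transported, so no sign of
  a permutation has to be recorded.\<close>

lemma alternating_insort:
  "alternating f \<Longrightarrow> f (insort a ks) = 0 \<Longrightarrow> f (a # ks) = 0"
proof (induction ks arbitrary: f)
  case (Cons k ks)
  show ?case
  proof (cases "a \<le> k")
    case False
    then have "f (k # a # ks) = 0"
      using Cons.prems(2) by (intro Cons.IH[OF alternating_Cons[OF Cons.prems(1)]]) simp
    then show ?thesis
      using alternatingD[OF Cons.prems(1), of "[]" a k ks] by simp
  qed (use Cons.prems in simp)
qed simp

lemma alternating_sort: "alternating f \<Longrightarrow> f (sort ks) = 0 \<Longrightarrow> f ks = 0"
proof (induction ks arbitrary: f)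
  case (Cons k ks)
  have "f (k # sort ks) = 0"
    using Cons.prems(2) by (intro alternating_insort[OF Cons.prems(1)]) simp
  then show ?case
    by (rule Cons.IH[OF alternating_Cons[OF Cons.prems(1)]])
qed simp

text \<open>Swapping two adjacent entries interchanges the two faces that lack one of them, which
  carry opposite signs; in every other face the swap remains and changes the sign.\<close>

lemma alternating_face_sum:
  assumes "alternating f"
  shows "alternating (face_sum f)"
proof -
  have "face_sum f (p @ a # b # q) = - face_sum f (p @ b # a # q)" for p a b q
    using assms
  proof (induction p arbitrary: f)
    case Nil
    have "face_sum (\<lambda>l. f (a # b # l)) q = - face_sum (\<lambda>l. f (b # a # l)) q"
      using alternatingD[OF Nil, of "[]" a b]
      by (simp add: face_sum_def sum_negf)
    then show ?case
      by (simp add: face_sum_Cons)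
  next
    case (Cons c p)
    then show ?case
      using Cons.IH[OF alternating_Cons[OF Cons.prems]] alternatingD[OF Cons.prems, of p a b q]
      by (simp add: face_sum_Cons)
  qed
  then show ?thesis unfolding alternating_def by blast
qed

section \<open>Inversions as signs of lists, and the alternating extension\<close>

fun inversions :: "'i::linorder list \<Rightarrow> nat" where
  "inversions [] = 0"
| "inversions (x # xs) = length (filter (\<lambda>y. y < x) xs) + inversions xs"

lemma card_inversions:
  "card {(a, b). a < b \<and> b < length js \<and> js ! b < js ! a} = inversions js"
proof (induction js)
  case (Cons x xs)
  let ?A = "{b. b < length xs \<and> xs ! b < x}"
  let ?B = "{(a, b). a < b \<and> b < length xs \<and> xs ! b < xs ! a}"
  \<comment> \<open>An inversion involves position 0, and is then given by an entry below
    \<open>x\<close>, or it is an inversion of \<open>xs\<close> with both positions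
    shifted.\<close>
  have "{(a, b). a < b \<and> b < length (x # xs) \<and> (x # xs) ! b < (x # xs) ! a} =
      (\<lambda>b. (0, Suc b)) ` ?A \<union> map_prod Suc Suc ` ?B" (is "?L = ?R")
  proof (rule Set.set_eqI)
    fix z :: "nat \<times> nat"
    obtain a b where z: "z = (a, b)" by fastforce
    show "z \<in> ?L \<longleftrightarrow> z \<in> ?R"
      unfolding z by (cases a; cases b) auto
  qed
  moreover have "finite ?B"
    by (rule finite_subset[of _ "{..<length xs} \<times> {..<length xs}"]) auto
  moreover have "card ((\<lambda>b. (0::nat, Suc b)) ` ?A) = card ?A"
    by (rule card_image) (auto simp: inj_on_def)
  moreover have "card (map_prod Suc Suc ` ?B) = card ?B"
    by (rule card_image) (auto simp: inj_on_def)
  moreover have "(\<lambda>b. (0::nat, Suc b)) ` ?A \<inter> map_prod Suc Suc ` ?B = {}"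
    by auto
  ultimately have "card {(a, b). a < b \<and> b < length (x # xs) \<and> (x # xs) ! b < (x # xs) ! a} =
      card ?A + card ?B"
    by (simp add: card_Un_disjoint)
  then show ?case
    using Cons by (simp add: length_filter_conv_card)
qed simp

text \<open>Only the relation between the two swapped entries changes, so the count changes by
  one.\<close>

lemma inversions_swap:
  "a \<noteq> b \<Longrightarrow> (- 1 :: int) ^ inversions (p @ a # b # q) = - ((- 1) ^ inversions (p @ b # a # q))"
  by (induction p) (auto simp: power_add)

lemma inversions_sorted: "sorted js \<Longrightarrow> inversions js = 0"
  by (induction js) (auto simp: filter_empty_conv not_less)

lemma alt_ext_inversions:
  "alt_ext I U k \<eta> js = (if distinct js \<and> set js \<in> nerve_simplices I U k
     then (- 1) ^ inversions js * \<eta> (set js) else 0)"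
  by (simp add: alt_ext_def card_inversions)

lemma alternating_alt_ext: "alternating (alt_ext I U k \<eta>)"
  unfolding alternating_def
proof (intro allI)
  fix p q :: "'a list" and a b
  have "set (p @ a # b # q) = set (p @ b # a # q)" by auto
  then show "alt_ext I U k \<eta> (p @ a # b # q) = - alt_ext I U k \<eta> (p @ b # a # q)"
    by (cases "a = b") (auto simp: alt_ext_inversions inversions_swap[of a b] simp del: set_append)
qed

lemma alt_ext_sorted:
  "sorted js \<Longrightarrow> distinct js \<Longrightarrow> set js \<in> nerve_simplices I U k \<Longrightarrow> alt_ext I U k \<eta> js = \<eta> (set js)"
  by (simp add: alt_ext_inversions inversions_sorted)

lemma set_mem_nerve_simplices:
  assumes "js \<in> tuples I k" "distinct js" "overlap U js \<noteq> {}"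
  shows "set js \<in> nerve_simplices I U k"
  using assms distinct_card[of js] by (simp add: nerve_simplices_def tuples_def overlap_def)

lemma set_omit_distinct: "distinct ks \<Longrightarrow> r < length ks \<Longrightarrow> set (omit r ks) = set ks - {ks ! r}"
proof (induction ks arbitrary: r)
  case (Cons k ks)
  then show ?case
    by (cases r) (auto simp: in_set_conv_nth)
qed simp

lemma distinct_omit: "distinct ks \<Longrightarrow> distinct (omit r ks)"
proof (induction ks arbitrary: r)
  case (Cons k ks)
  then show ?case
    using set_omit[of _ ks] by (cases r) auto
qed (simp add: omit_def)

lemma sorted_omit: "sorted ks \<Longrightarrow> sorted (omit r ks)"
proof (induction ks arbitrary: r)
  case (Cons k ks)
  then show ?case
    using set_omit[of _ ks] by (cases r) auto
qed (simp add: omit_def)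

text \<open>
  Both sides are alternating in \<open>ks\<close>, so it suffices to compare them on strictly increasing lists.
\<close>
lemma face_sum_alt_ext:
  fixes I :: "'i::linorder set"
  assumes ks: "ks \<in> tuples I (Suc k)" and ne: "overlap U ks \<noteq> {}"
  shows "face_sum (alt_ext I U k \<eta>) ks = alt_ext I U (Suc k) (nerve_coboundary I U k \<eta>) ks"
proof -
  let ?h = "\<lambda>l. face_sum (alt_ext I U k \<eta>) l - alt_ext I U (Suc k) (nerve_coboundary I U k \<eta>) l"
  have alt: "alternating ?h"
    by (intro alternating_diff alternating_face_sum alternating_alt_ext)
  have "?h ks = 0"
  proof (cases "distinct ks")
    case True
    let ?s = "sort ks"
    have s: "?s \<in> tuples I (Suc k)" "distinct ?s" "overlap U ?s \<noteq> {}"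
      using ks ne True by (auto simp: tuples_def overlap_def)
    note S = set_mem_nerve_simplices[OF s]
    have list: "sorted_list_of_set (set ?s) = ?s"
      using True by (simp add: sorted_list_of_set_sort_remdups distinct_remdups_id)
    \<comment> \<open>Every face of an increasing list is increasing, so no sign arises; entry
      \<open>j\<close> is the vertex that \<open>nerve_coboundary\<close> removes at place
      \<open>j\<close>.\<close>
    have "alt_ext I U k \<eta> (omit j ?s) = \<eta> (set ?s - {?s ! j})" if j: "j \<le> Suc k" for j
    proof -
      have "overlap U (omit j ?s) \<noteq> {}"
        using s(3) overlap_omit[of U ?s j] by blast
      then have "set (omit j ?s) \<in> nerve_simplices I U k"
        by (rule set_mem_nerve_simplices[OF omit_tuples[OF s(1) j] distinct_omit[OF s(2)]])
      then have "alt_ext I U k \<eta> (omit j ?s) = \<eta> (set (omit j ?s))"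
        using s(2) by (intro alt_ext_sorted sorted_omit distinct_omit) auto
      also have "set (omit j ?s) = set ?s - {?s ! j}"
        using s j by (intro set_omit_distinct) (auto simp: tuples_def)
      finally show ?thesis .
    qed
    then have "face_sum (alt_ext I U k \<eta>) ?s = (\<Sum>j\<le>Suc k. (- 1) ^ j * \<eta> (set ?s - {?s ! j}))"
      using s(1) by (auto simp: face_sum_def tuples_def lessThan_Suc_atMost intro!: sum.cong)
    moreover have "alt_ext I U (Suc k) (nerve_coboundary I U k \<eta>) ?s = nerve_coboundary I U k \<eta> (set ?s)"
      using s S by (intro alt_ext_sorted) auto
    ultimately have "?h ?s = 0"
      using S list by (simp add: nerve_coboundary_def)
    then show ?thesis
      by (rule alternating_sort[OF alt])
  qed (rule alternating_not_distinct[OF alt])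
  then show ?thesis by simp
qed

section \<open>From the nerve to Cech cohomology\<close>

lemma carrier_nerve_cochains: "\<sigma> \<in> carrier (nerve_cochains I U k) \<longleftrightarrow> \<sigma> \<in> extensional (nerve_simplices I U k)"
  by (simp add: nerve_cochains_def PiE_def)

lemma mult_nerve_cochains:
  "\<sigma> \<otimes>\<^bsub>nerve_cochains I U k\<^esub> \<tau> = (\<lambda>S\<in>nerve_simplices I U k. \<sigma> S + \<tau> S)"
  by (simp add: nerve_cochains_def)

lemma one_nerve_cochains: "\<one>\<^bsub>nerve_cochains I U k\<^esub> = (\<lambda>S\<in>nerve_simplices I U k. 0)"
  by (simp add: nerve_cochains_def)

lemma nth_sorted_list_of_set_mem:
  assumes "S \<in> nerve_simplices I U (Suc k)" "j \<le> Suc k"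
  shows "sorted_list_of_set S ! j \<in> S"
proof -
  have "j < length (sorted_list_of_set S)"
    using assms by (simp add: nerve_simplices_def)
  then have "sorted_list_of_set S ! j \<in> set (sorted_list_of_set S)"
    by (rule nth_mem)
  then show ?thesis
    using assms by (simp add: nerve_simplices_def)
qed

lemma nerve_simplices_face:
  assumes "S \<in> nerve_simplices I U (Suc k)" "v \<in> S"
  shows "S - {v} \<in> nerve_simplices I U k"
  using assms by (auto simp: nerve_simplices_def)

lemma cochain_groups_nerve: "cochain_groups (nerve_cochains I U) (nerve_coboundary I U)"
proof (rule cochain_groups.intro)
  show "comm_group (nerve_cochains I U k)" for k
    unfolding nerve_cochains_def by (intro comm_group_product_group abelian_integer_group)
  show "nerve_coboundary I U k \<in> hom (nerve_cochains I U k) (nerve_cochains I U (Suc k))" for k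
  proof (rule homI)
    show "nerve_coboundary I U k \<sigma> \<in> carrier (nerve_cochains I U (Suc k))" for \<sigma>
      by (simp add: carrier_nerve_cochains nerve_coboundary_def)
    fix \<sigma> \<tau> :: "'a set \<Rightarrow> int"
    have face: "S - {sorted_list_of_set S ! j} \<in> nerve_simplices I U k"
      if "S \<in> nerve_simplices I U (Suc k)" "j \<le> Suc k" for S j
      using that by (intro nerve_simplices_face nth_sorted_list_of_set_mem)
    have "(\<Sum>j\<le>Suc k. (- 1) ^ j * (\<sigma> \<otimes>\<^bsub>nerve_cochains I U k\<^esub> \<tau>) (S - {sorted_list_of_set S ! j})) =
        (\<Sum>j\<le>Suc k. (- 1) ^ j * \<sigma> (S - {sorted_list_of_set S ! j})) +
        (\<Sum>j\<le>Suc k. (- 1) ^ j * \<tau> (S - {sorted_list_of_set S ! j}))"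
      if "S \<in> nerve_simplices I U (Suc k)" for S
      unfolding sum.distrib[symmetric]
      using face[OF that] by (intro sum.cong) (auto simp: mult_nerve_cochains algebra_simps)
    then show "nerve_coboundary I U k (\<sigma> \<otimes>\<^bsub>nerve_cochains I U k\<^esub> \<tau>) =
        nerve_coboundary I U k \<sigma> \<otimes>\<^bsub>nerve_cochains I U (Suc k)\<^esub> nerve_coboundary I U k \<tau>"
      unfolding nerve_coboundary_def mult_nerve_cochains[of I U "Suc k"] by (intro restrict_ext) simp
  qed
qed

lemma alt_ext_mult:
  "alt_ext I U k (\<sigma> \<otimes>\<^bsub>nerve_cochains I U k\<^esub> \<tau>) js = alt_ext I U k \<sigma> js + alt_ext I U k \<tau> js"
  by (simp add: alt_ext_def mult_nerve_cochains algebra_simps)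

lemma alt_ext_one: "alt_ext I U k \<one>\<^bsub>nerve_cochains I U k\<^esub> js = 0"
  by (simp add: alt_ext_def one_nerve_cochains)

text \<open>\<open>alt_ext\<close> vanishes on lists with a repetition, so at a nonzero value
  \<open>t\<close> lies outside \<open>l\<close> and is recovered from the simplex
  \<open>insert t (set l)\<close>. Finite support of the cochain thus makes the sums in
  \<open>omega\<close> finite.\<close>

lemma finite_support_alt_ext:
  assumes "\<eta> \<in> carrier (nerve_cochains_fs I U (Suc k))"
  shows "finite {t \<in> I. alt_ext I U (Suc k) \<eta> (l @ [t]) \<noteq> 0}" (is "finite ?T")
proof (rule finite_imageD)
  have "finite {S \<in> nerve_simplices I U (Suc k). \<eta> S \<noteq> 0}"
    using assms by (simp add: nerve_cochains_fs_def carrier_sum_group)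
  moreover have "(\<lambda>t. insert t (set l)) ` ?T \<subseteq> {S \<in> nerve_simplices I U (Suc k). \<eta> S \<noteq> 0}"
    by (auto simp: alt_ext_def split: if_splits)
  ultimately show "finite ((\<lambda>t. insert t (set l)) ` ?T)"
    by (rule finite_subset[rotated])
  show "inj_on (\<lambda>t. insert t (set l)) ?T"
    by (rule inj_onI) (auto simp: alt_ext_def split: if_splits)
qed

lemma face_sum_of_int: "face_sum (\<lambda>l. of_int (f l)) ks = of_int (face_sum f ks)"
  by (simp add: face_sum_def)

text \<open>The new index sits last, as in \<eta>_rst. The face omitting it has sign -1 when
  \<open>ks\<close> is a triple, which is what gives \<delta>g the value +\<eta>.\<close>

lemma face_sum_snoc: "face_sum f (ks @ [t]) = face_sum (\<lambda>l. f (l @ [t])) ks + (- 1) ^ length ks * f ks"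
proof -
  have "omit j (ks @ [t]) = omit j ks @ [t]" if "j < length ks" for j
    using that by (simp add: omit_def)
  then show ?thesis
    by (simp add: face_sum_def omit_def)
qed

text \<open>The part of \<open>V\<close> with value \<open>f b\<close> and the part with any other
  value are both open, by local constancy, so they cannot both be nonempty.\<close>

lemma const_Z_section_constant:
  assumes con: "connectedin X V" and f: "f \<in> carrier (sections (const_Z X) V)"
    and b: "b \<in> V" "b' \<in> V"
  shows "f b = f b'"
proof (rule ccontr)
  assume ne: "f b \<noteq> f b'"
  have loc: "\<exists>W. openin X W \<and> x \<in> W \<and> W \<subseteq> V \<and> (\<forall>y\<in>W. f y = f x)" if "x \<in> V" for x
    using f that by (simp add: const_Z_def)
  have op: "openin X {x \<in> V. P (f x)}" for P
  proof (subst openin_subopen, intro ballI)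
    fix x assume x: "x \<in> {x \<in> V. P (f x)}"
    then have "x \<in> V" by blast
    from loc[OF this] obtain W
      where W: "openin X W \<and> x \<in> W \<and> W \<subseteq> V \<and> (\<forall>y\<in>W. f y = f x)" ..
    have "W \<subseteq> {x \<in> V. P (f x)}"
    proof
      fix y assume "y \<in> W"
      with W have "f y = f x" "y \<in> V" by blast+
      with x show "y \<in> {x \<in> V. P (f x)}" by simp
    qed
    with W show "\<exists>T. openin X T \<and> x \<in> T \<and> T \<subseteq> {x \<in> V. P (f x)}" by blast
  qed
  show False
    by (rule connectedinD[OF con op[of "\<lambda>n. n = f b"] op[of "\<lambda>n. n \<noteq> f b"]]) (use b ne in auto)
qed

lemma has_sum_sum:
  fixes f :: "'j \<Rightarrow> 'i \<Rightarrow> real"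
  assumes "\<And>j. j \<in> J \<Longrightarrow> (f j has_sum s j) I"
  shows "((\<lambda>t. \<Sum>j\<in>J. f j t) has_sum (\<Sum>j\<in>J. s j)) I"
  using assms by (induction J rule: infinite_finite_induct) (auto intro: has_sum_add)

text \<open>The cochain map underlying \<open>Psi\<close>, given in every degree so that its
  compatibility with coboundaries can be stated.\<close>

definition nerve_to_cech ::
    "'i::linorder set \<Rightarrow> ('i \<Rightarrow> 'a set) \<Rightarrow> nat \<Rightarrow> ('i set \<Rightarrow> int) \<Rightarrow> 'i list \<Rightarrow> 'a \<Rightarrow> int" where
  "nerve_to_cech I U k \<sigma> = (\<lambda>js\<in>tuples I k. \<lambda>b\<in>overlap U js. alt_ext I U k \<sigma> js)"

section \<open>Injectivity of \<open>Psi\<close>, inversion of \<open>Delta\<close> and the class of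
  \<open>omega\<close>\<close>

context
  fixes X :: "'a topology" and I :: "'i::linorder set" and U :: "'i \<Rightarrow> 'a set"
  assumes cover: "open_cover X I U"
begin

interpretation Z: abelian_presheaf X "const_Z X" by (rule abelian_presheaf_const_Z)
interpretation incl: presheaf_morphism X "const_Z X" "cont_C X" incl_Z by (rule incl_morphism)
interpretation N: cochain_groups "nerve_cochains I U" "nerve_coboundary I U" by (rule cochain_groups_nerve)
interpretation E: short_exact_cochains "cech_cochains I U (const_Z X)" "cech_coboundary I U (const_Z X)"
    "cech_cochains I U (cont_C X)" "cech_coboundary I U (cont_C X)"
    "cech_cochains I U (Im_exp X)" "cech_coboundary I U (Im_exp X)"
    "\<lambda>n. cech_map I U n incl_Z" "\<lambda>n. cech_map I U n exp_map"
  by (rule exponential_sequence[OF cover])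

lemma nerve_to_cech_closed: "nerve_to_cech I U k \<sigma> \<in> carrier (cech_cochains I U (const_Z X) k)"
  unfolding Z.carrier_cech[OF cover]
  by (auto simp: nerve_to_cech_def intro!: restrict_const_Z openin_overlap[OF cover])

lemma nerve_to_cech_mult:
  "nerve_to_cech I U k (\<sigma> \<otimes>\<^bsub>nerve_cochains I U k\<^esub> \<tau>) =
    nerve_to_cech I U k \<sigma> \<otimes>\<^bsub>cech_cochains I U (const_Z X) k\<^esub> nerve_to_cech I U k \<tau>"
  by (auto simp: nerve_to_cech_def cech_cochains_def mult_const_Z alt_ext_mult intro!: restrict_ext)

lemma nerve_to_cech_one: "nerve_to_cech I U k \<one>\<^bsub>nerve_cochains I U k\<^esub> = \<one>\<^bsub>cech_cochains I U (const_Z X) k\<^esub>"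
  by (auto simp: nerve_to_cech_def cech_cochains_def one_const_Z alt_ext_one intro!: restrict_ext)

text \<open>Carried over from complex functions: \<open>incl_Z\<close> commutes with the coboundary,
  and an integer is determined by its image in the complex numbers.\<close>

lemma coboundary_const_Z:
  assumes f: "f \<in> carrier (cech_cochains I U (const_Z X) n)"
    and ks: "ks \<in> tuples I (Suc n)" and b: "b \<in> overlap U ks"
  shows "cech_coboundary I U (const_Z X) n f ks b = face_sum (\<lambda>js. f js b) ks"
proof -
  have "of_int (cech_coboundary I U (const_Z X) n f ks b) =
      cech_map I U (Suc n) incl_Z (cech_coboundary I U (const_Z X) n f) ks b"
    using ks b by (simp add: cech_map_def incl_Z_def)
  also have "\<dots> = face_sum (\<lambda>js. cech_map I U n incl_Z f js b) ks"
    unfolding incl.cech_map_coboundary[OF cover f]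
    by (rule coboundary_cont_C[OF cover incl.cech_map_closed[OF cover f] ks b])
  also have "\<dots> = face_sum (\<lambda>js. of_int (f js b)) ks"
    using ks b overlap_omit[of U ks] omit_tuples[OF ks]
    by (intro face_sum_cong) (auto simp: cech_map_def incl_Z_def tuples_def)
  finally show ?thesis
    by (simp add: face_sum_of_int)
qed

text \<open>Both sides are compared at points of the overlap. Such a point shows the overlap to be
  nonempty, as \<open>face_sum_alt_ext\<close> requires; over an empty overlap there is only one
  section.\<close>

lemma nerve_to_cech_coboundary:
  "cech_coboundary I U (const_Z X) k (nerve_to_cech I U k \<sigma>) =
    nerve_to_cech I U (Suc k) (nerve_coboundary I U k \<sigma>)" (is "?l = ?r")
proof (rule extensionalityI)
  show "?l \<in> extensional (tuples I (Suc k))" "?r \<in> extensional (tuples I (Suc k))"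
    by (simp_all add: cech_coboundary_def nerve_to_cech_def)
  fix ks assume ks: "ks \<in> tuples I (Suc k)"
  have "?l \<in> carrier (cech_cochains I U (const_Z X) (Suc k))"
    by (rule Z.cech_coboundary_closed[OF cover nerve_to_cech_closed])
  then have "?l ks \<in> carrier (sections (const_Z X) (overlap U ks))"
    using ks unfolding Z.carrier_cech[OF cover] by blast
  then have "?l ks \<in> extensional (overlap U ks)"
    unfolding carrier_const_Z[OF openin_overlap[OF cover ks]] ..
  moreover have "?r ks \<in> extensional (overlap U ks)"
    using ks by (simp add: nerve_to_cech_def)
  ultimately show "?l ks = ?r ks"
  proof (rule extensionalityI)
    fix b assume b: "b \<in> overlap U ks"
    have "?l ks b = face_sum (\<lambda>js. nerve_to_cech I U k \<sigma> js b) ks"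
      by (rule coboundary_const_Z[OF nerve_to_cech_closed ks b])
    also have "\<dots> = face_sum (alt_ext I U k \<sigma>) ks"
      using ks b overlap_omit[of U ks] omit_tuples[OF ks]
      by (intro face_sum_cong) (auto simp: nerve_to_cech_def tuples_def)
    also have "\<dots> = alt_ext I U (Suc k) (nerve_coboundary I U k \<sigma>) ks"
      using b by (intro face_sum_alt_ext ks) auto
    finally show "?l ks b = ?r ks b"
      using ks b by (simp add: nerve_to_cech_def)
  qed
qed

lemma nerve_to_cech_cocycle:
  assumes "\<sigma> \<in> cocycles (nerve_cochains I U) (nerve_coboundary I U) k"
  shows "nerve_to_cech I U k \<sigma> \<in> cocycles (cech_cochains I U (const_Z X)) (cech_coboundary I U (const_Z X)) k"
  using assms
  by (simp add: E.A.cocycles_iff N.cocycles_iff nerve_to_cech_closed nerve_to_cech_coboundary nerve_to_cech_one)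

text \<open>Nerve coboundaries go to Cech coboundaries, so all representatives yield one class and
  \<open>the_elem\<close> meets a singleton.\<close>

lemma Psi_coho_class:
  assumes \<sigma>: "\<sigma> \<in> carrier (nerve_cochains I U 2)"
  shows "Psi X I U (coho_class (nerve_cochains I U) (nerve_coboundary I U) 2 \<sigma>) =
    cech_class I U (const_Z X) 2 (nerve_to_cech I U 2 \<sigma>)"
proof -
  let ?c = "coho_class (nerve_cochains I U) (nerve_coboundary I U) 2 \<sigma>"
  have "cech_class I U (const_Z X) 2 (nerve_to_cech I U 2 \<tau>) =
      cech_class I U (const_Z X) 2 (nerve_to_cech I U 2 \<sigma>)" if "\<tau> \<in> ?c" for \<tau>
  proof -
    obtain z where z: "z \<in> carrier (nerve_cochains I U (Suc 0))"
      "\<tau> = nerve_coboundary I U (Suc 0) z \<otimes>\<^bsub>nerve_cochains I U 2\<^esub> \<sigma>"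
      using \<open>\<tau> \<in> ?c\<close> unfolding N.coho_class_mem_iff numeral_2_eq_2 by auto
    have "nerve_to_cech I U 2 \<tau> = cech_coboundary I U (const_Z X) (Suc 0) (nerve_to_cech I U (Suc 0) z)
        \<otimes>\<^bsub>cech_cochains I U (const_Z X) 2\<^esub> nerve_to_cech I U 2 \<sigma>"
      unfolding z(2) nerve_to_cech_mult nerve_to_cech_coboundary by (simp add: numeral_2_eq_2)
    then show ?thesis
      using nerve_to_cech_closed[of "Suc 0" z]
      by (subst E.A.coho_class_eq_iff[OF nerve_to_cech_closed nerve_to_cech_closed])
        (auto simp: numeral_2_eq_2)
  qed
  then have "(\<lambda>\<tau>. cech_class I U (const_Z X) 2 (nerve_to_cech I U 2 \<tau>)) ` ?c =
      {cech_class I U (const_Z X) 2 (nerve_to_cech I U 2 \<sigma>)}"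
    using N.coho_class_self[OF \<sigma>] by blast
  then show ?thesis
    unfolding Psi_def nerve_to_cech_def by simp
qed

text \<open>
  A \<open>\<int>\<close>-valued Cech cochain in degree \<open>k\<close> is constant on each connected overlap, so restricting it
  to increasing tuples turns a Cech primitive into a primitive on the nerve.
\<close>
lemma nerve_to_cech_reflects_coboundaries:
  assumes con: "\<And>js. js \<in> tuples I k \<Longrightarrow> overlap U js = {} \<or> connectedin X (overlap U js)"
    and a: "a \<in> carrier (cech_cochains I U (const_Z X) k)"
    and \<sigma>: "\<sigma> \<in> carrier (nerve_cochains I U (Suc k))" and \<tau>: "\<tau> \<in> carrier (nerve_cochains I U (Suc k))"
    and eq: "nerve_to_cech I U (Suc k) \<sigma> = cech_coboundary I U (const_Z X) k a
      \<otimes>\<^bsub>cech_cochains I U (const_Z X) (Suc k)\<^esub> nerve_to_cech I U (Suc k) \<tau>"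
  shows "\<exists>z\<in>carrier (nerve_cochains I U k).
    \<sigma> = nerve_coboundary I U k z \<otimes>\<^bsub>nerve_cochains I U (Suc k)\<^esub> \<tau>"
proof -
  \<comment> \<open>Any point of the overlap would do, since \<open>a\<close> is constant there;
    increasing order selects one tuple for each simplex.\<close>
  define z where "z = (\<lambda>S\<in>nerve_simplices I U k.
    a (sorted_list_of_set S) (SOME b. b \<in> overlap U (sorted_list_of_set S)))"
  have a_const: "a js b = a js b'" if "js \<in> tuples I k" "b \<in> overlap U js" "b' \<in> overlap U js" for js b b'
    using con[OF that(1)] that a
    by (intro const_Z_section_constant[of X "overlap U js"]) (auto simp: Z.carrier_cech[OF cover])
  have "\<sigma> S = (nerve_coboundary I U k z \<otimes>\<^bsub>nerve_cochains I U (Suc k)\<^esub> \<tau>) S"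
    if S: "S \<in> nerve_simplices I U (Suc k)" for S
  proof -
    define js where "js = sorted_list_of_set S"
    have finS: "finite S" and setS: "set js = S" and js: "js \<in> tuples I (Suc k)" "distinct js" "sorted js"
      using S by (auto simp: js_def nerve_simplices_def tuples_def)
    obtain b where b: "b \<in> overlap U js"
      using S setS by (auto simp: overlap_def nerve_simplices_def)
    have alt: "nerve_to_cech I U (Suc k) \<rho> js b = \<rho> S" for \<rho>
      using js b S setS alt_ext_sorted[of js I U "Suc k" \<rho>] by (simp add: nerve_to_cech_def)
    have face: "a (omit j js) b = z (S - {js ! j})" if j: "j \<le> Suc k" for j
    proof -
      have jl: "j < length js" using js j by (simp add: tuples_def)
      have om: "set (omit j js) = S - {js ! j}"
        using set_omit_distinct[OF js(2) jl] setS by simp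
      have list: "sorted_list_of_set (S - {js ! j}) = omit j js"
        using js sorted_omit[of js j] distinct_omit[of js j] unfolding om[symmetric]
        by (simp add: sorted_list_of_set_sort_remdups distinct_remdups_id sorted_sort_id)
      have "S - {js ! j} \<in> nerve_simplices I U k"
        using j S unfolding js_def by (intro nerve_simplices_face nth_sorted_list_of_set_mem)
      then have "z (S - {js ! j}) = a (omit j js) (SOME b. b \<in> overlap U (omit j js))"
        by (simp add: z_def list)
      moreover have "b \<in> overlap U (omit j js)"
        using b overlap_omit[of U js j] by blast
      ultimately show ?thesis
        using a_const[OF omit_tuples[OF js(1) j]] by (metis someI)
    qed
    have "\<sigma> S = (cech_coboundary I U (const_Z X) k a
        \<otimes>\<^bsub>cech_cochains I U (const_Z X) (Suc k)\<^esub> nerve_to_cech I U (Suc k) \<tau>) js b"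
      using alt[of \<sigma>] eq by simp
    also have "\<dots> = cech_coboundary I U (const_Z X) k a js b + nerve_to_cech I U (Suc k) \<tau> js b"
      using js b by (simp add: cech_cochains_def mult_const_Z)
    also have "\<dots> = face_sum (\<lambda>l. a l b) js + \<tau> S"
      by (simp add: coboundary_const_Z[OF a js(1) b] alt)
    also have "face_sum (\<lambda>l. a l b) js = (\<Sum>j\<le>Suc k. (- 1) ^ j * z (S - {js ! j}))"
      using js(1) face by (auto simp: face_sum_def tuples_def lessThan_Suc_atMost intro!: sum.cong)
    finally show ?thesis
      using S by (simp add: mult_nerve_cochains nerve_coboundary_def js_def)
  qed
  then have "\<sigma> = nerve_coboundary I U k z \<otimes>\<^bsub>nerve_cochains I U (Suc k)\<^esub> \<tau>"
    using \<sigma> by (intro extensionalityI[of _ "nerve_simplices I U (Suc k)"])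
      (auto simp: carrier_nerve_cochains mult_nerve_cochains)
  moreover have "z \<in> carrier (nerve_cochains I U k)"
    by (simp add: carrier_nerve_cochains z_def)
  ultimately show ?thesis by blast
qed

text \<open>Injectivity in degree 2 is about primitives in degree 1, and 1-cochains live on pairwise
  intersections; that is where connectedness enters.\<close>

lemma Psi_mon:
  assumes "\<And>r t. r \<in> I \<Longrightarrow> t \<in> I \<Longrightarrow> U r \<inter> U t = {} \<or> connectedin X (U r \<inter> U t)"
  shows "Psi X I U \<in> mon (nerve_cohomology I U 2) (cech_cohomology I U (const_Z X) 2)"
proof -
  have con: "overlap U js = {} \<or> connectedin X (overlap U js)" if "js \<in> tuples I (Suc 0)" for js
  proof -
    obtain r t where "js = [r, t]" "r \<in> I" "t \<in> I"
      using \<open>js \<in> tuples I (Suc 0)\<close> by (auto simp: tuples_def length_Suc_conv)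
    then show ?thesis
      using assms[of r t] by (simp add: overlap_def)
  qed
  show ?thesis
    unfolding mon_def
  proof (intro CollectI conjI homI inj_onI)
    show "Psi X I U c \<in> carrier (cech_cohomology I U (const_Z X) 2)" if "c \<in> carrier (nerve_cohomology I U 2)" for c
      using that nerve_to_cech_cocycle
      by (auto simp: N.carrier_cohomology E.A.carrier_cohomology Psi_coho_class N.cocycles_iff)
  next
    fix c c' assume "c \<in> carrier (nerve_cohomology I U 2)" "c' \<in> carrier (nerve_cohomology I U 2)"
    then obtain \<sigma> \<tau> where \<sigma>: "\<sigma> \<in> carrier (nerve_cochains I U 2)" "\<tau> \<in> carrier (nerve_cochains I U 2)"
      "c = coho_class (nerve_cochains I U) (nerve_coboundary I U) 2 \<sigma>"
      "c' = coho_class (nerve_cochains I U) (nerve_coboundary I U) 2 \<tau>"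
      by (auto simp: N.carrier_cohomology N.cocycles_iff)
    have "\<sigma> \<otimes>\<^bsub>nerve_cochains I U 2\<^esub> \<tau> \<in> carrier (nerve_cochains I U 2)"
      by (simp add: carrier_nerve_cochains mult_nerve_cochains)
    then show "Psi X I U (c \<otimes>\<^bsub>nerve_cohomology I U 2\<^esub> c') =
        Psi X I U c \<otimes>\<^bsub>cech_cohomology I U (const_Z X) 2\<^esub> Psi X I U c'"
      using \<sigma> by (simp add: N.mult_cohomology E.A.mult_cohomology Psi_coho_class nerve_to_cech_mult
          nerve_to_cech_closed)
  next
    fix c c' assume "c \<in> carrier (nerve_cohomology I U 2)" "c' \<in> carrier (nerve_cohomology I U 2)"
      and eq: "Psi X I U c = Psi X I U c'"
    then obtain \<sigma> \<tau> where \<sigma>: "\<sigma> \<in> carrier (nerve_cochains I U 2)" "\<tau> \<in> carrier (nerve_cochains I U 2)"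
      "c = coho_class (nerve_cochains I U) (nerve_coboundary I U) 2 \<sigma>"
      "c' = coho_class (nerve_cochains I U) (nerve_coboundary I U) 2 \<tau>"
      by (auto simp: N.carrier_cohomology N.cocycles_iff)
    have "cech_class I U (const_Z X) 2 (nerve_to_cech I U 2 \<sigma>) =
        cech_class I U (const_Z X) 2 (nerve_to_cech I U 2 \<tau>)"
      using eq \<sigma> by (simp add: Psi_coho_class)
    then obtain a where "a \<in> carrier (cech_cochains I U (const_Z X) (Suc 0))"
      "nerve_to_cech I U 2 \<sigma> = cech_coboundary I U (const_Z X) (Suc 0) a
        \<otimes>\<^bsub>cech_cochains I U (const_Z X) 2\<^esub> nerve_to_cech I U 2 \<tau>"
      unfolding E.A.coho_class_eq_iff[OF nerve_to_cech_closed nerve_to_cech_closed]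
      by (auto simp: numeral_2_eq_2)
    then have "\<exists>z\<in>carrier (nerve_cochains I U (Suc 0)).
        \<sigma> = nerve_coboundary I U (Suc 0) z \<otimes>\<^bsub>nerve_cochains I U (Suc (Suc 0))\<^esub> \<tau>"
      using nerve_to_cech_reflects_coboundaries[OF con] \<sigma>(1,2) unfolding numeral_2_eq_2 by blast
    then show "c = c'"
      unfolding \<sigma>(3,4) N.coho_class_eq_iff[OF \<sigma>(1,2)] by (auto simp: numeral_2_eq_2)
  qed
qed

text \<open>The connecting map from degree 1 to degree 2 sits between the cohomology groups of the
  continuous functions in degrees 1 and 2, both trivial.\<close>

lemma Delta_iso:
  assumes "dominated_partition_of_unity X I U \<phi>"
  shows "Delta X I U \<in> iso (cech_cohomology I U (Im_exp X) 1) (cech_cohomology I U (const_Z X) 2)"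
  unfolding Delta_eq_connect[OF cover] numeral_2_eq_2 One_nat_def
  by (intro E.connect_iso cont_C_acyclic[OF cover assms])

lemma Delta_inv_iso:
  assumes "dominated_partition_of_unity X I U \<phi>"
  shows "Delta_inv X I U \<in> iso (cech_cohomology I U (const_Z X) 2) (cech_cohomology I U (Im_exp X) 1)"
proof (rule isoI)
  note iso = Delta_iso[OF assms]
  have bij: "bij_betw (Delta X I U) (carrier (cech_cohomology I U (Im_exp X) 1)) (carrier (cech_cohomology I U (const_Z X) 2))"
    using iso by (simp add: iso_def)
  then show bij': "bij_betw (Delta_inv X I U) (carrier (cech_cohomology I U (const_Z X) 2)) (carrier (cech_cohomology I U (Im_exp X) 1))"
    unfolding Delta_inv_def by (rule bij_betw_inv_into)
  show "Delta_inv X I U \<in> hom (cech_cohomology I U (const_Z X) 2) (cech_cohomology I U (Im_exp X) 1)"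
  proof (rule homI)
    show cl: "Delta_inv X I U c \<in> carrier (cech_cohomology I U (Im_exp X) 1)"
      if "c \<in> carrier (cech_cohomology I U (const_Z X) 2)" for c
      using bij' that by (rule bij_betw_apply)
    fix c c' assume c: "c \<in> carrier (cech_cohomology I U (const_Z X) 2)" "c' \<in> carrier (cech_cohomology I U (const_Z X) 2)"
    let ?p = "Delta_inv X I U c \<otimes>\<^bsub>cech_cohomology I U (Im_exp X) 1\<^esub> Delta_inv X I U c'"
    have "?p \<in> carrier (cech_cohomology I U (Im_exp X) 1)"
      using cl[OF c(1)] cl[OF c(2)] E.C.cocycles_mult
      by (auto simp: E.C.carrier_cohomology E.C.mult_cohomology E.C.cocycles_iff)
    then have "Delta_inv X I U (Delta X I U ?p) = ?p"
      unfolding Delta_inv_def using bij by (intro inv_into_f_f) (auto simp: bij_betw_def)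
    moreover have "Delta X I U ?p = c \<otimes>\<^bsub>cech_cohomology I U (const_Z X) 2\<^esub> c'"
      using hom_mult[OF iso_imp_homomorphism[OF iso] cl[OF c(1)] cl[OF c(2)]] c bij
      by (simp add: Delta_inv_def f_inv_into_f bij_betw_def)
    ultimately show "Delta_inv X I U (c \<otimes>\<^bsub>cech_cohomology I U (const_Z X) 2\<^esub> c') = ?p"
      by simp
  qed
qed

text \<open>
  The continuous cochain \<open>g\<^sub>r\<^sub>s = \<Sum>t. \<phi>\<^sub>t \<eta>\<^sub>r\<^sub>s\<^sub>t\<close> satisfies \<open>\<delta> g = \<eta>\<close>: at a point of \<open>U t\<close> the
  cocycle condition on \<open>(r, s, u, t)\<close> turns the coefficient of \<open>\<phi>\<^sub>t\<close> in \<open>(\<delta> g)\<^sub>r\<^sub>s\<^sub>u\<close> into \<open>\<eta>\<^sub>r\<^sub>s\<^sub>u\<close>.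
\<close>
lemma Delta_omega:
  assumes part: "dominated_partition_of_unity X I U \<phi>"
    and \<eta>: "\<eta> \<in> cocycles (nerve_cochains I U) (nerve_coboundary I U) 2"
    and fin: "\<And>l b. b \<in> topspace X \<Longrightarrow> \<exists>F. finite F \<and> F \<subseteq> I \<and>
      eventually (\<lambda>x. \<forall>t\<in>I - F. zero_ext U \<phi> t x * of_int (alt_ext I U 2 \<eta> (l @ [t])) = 0) (nhdsin X b)"
  shows "cech_class I U (Im_exp X) 1 (omega I U \<phi> \<eta>) \<in> carrier (cech_cohomology I U (Im_exp X) 1)"
    and "Delta X I U (cech_class I U (Im_exp X) 1 (omega I U \<phi> \<eta>)) =
      cech_class I U (const_Z X) 2 (nerve_to_cech I U 2 \<eta>)"
proof -
  let ?A = "alt_ext I U 2 \<eta>"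
  define v where "v js x = (\<Sum>\<^sub>\<infinity>t\<in>I. zero_ext U \<phi> t x * of_int (?A (js @ [t])))" for js x
  define g where "g = (\<lambda>js\<in>tuples I 1. \<lambda>b\<in>overlap U js. complex_of_real (v js b))"
  have g: "g \<in> carrier (cech_cochains I U (cont_C X) 1)"
    unfolding abelian_presheaf.carrier_cech[OF abelian_presheaf_cont_C cover]
  proof (intro conjI ballI)
    fix js assume js: "js \<in> tuples I 1"
    have "(\<lambda>b\<in>overlap U js. complex_of_real (v js b)) \<in> carrier (sections (cont_C X) (overlap U js))"
    proof (intro restrict_cont_C openin_overlap[OF cover js] tendsto_of_real)
      fix b assume "b \<in> overlap U js"
      then have bX: "b \<in> topspace X"
        using openin_subset[OF openin_overlap[OF cover js]] by blast
      obtain F where F: "finite F" "F \<subseteq> I"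
        "eventually (\<lambda>x. \<forall>t\<in>I - F. zero_ext U \<phi> t x * of_int (?A (js @ [t])) = 0) (nhdsin X b)"
        using fin[OF bX] by blast
      show "(v js \<longlongrightarrow> v js b) (nhdsin X b)"
        unfolding v_def
        using F(2)
        by (intro locally_finite_sum_tendsto[OF F _ bX] tendsto_mult_right zero_ext_tendsto[OF cover part _ bX]) blast
    qed
    then show "g js \<in> carrier (sections (cont_C X) (overlap U js))"
      using js by (simp add: g_def)
  qed (simp add: g_def)
  have v_sum: "((\<lambda>t. zero_ext U \<phi> t b * of_int (?A (js @ [t]))) has_sum v js b) I"
    if bX: "b \<in> topspace X" for js b
  proof -
    obtain F where F: "finite F" "F \<subseteq> I"
      "eventually (\<lambda>x. \<forall>t\<in>I - F. zero_ext U \<phi> t x * of_int (?A (js @ [t])) = 0) (nhdsin X b)"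
      using fin[OF bX] by blast
    have "((\<lambda>t. zero_ext U \<phi> t b * of_int (?A (js @ [t]))) has_sum
        (\<Sum>t\<in>F. zero_ext U \<phi> t b * of_int (?A (js @ [t])))) I"
      using F(1,2) eventually_nhdsin_self[OF F(3) bX] by (intro has_sum_finite_neutralI) auto
    then show ?thesis
      unfolding v_def by (rule has_sum_infsum[OF has_sum_imp_summable])
  qed
  have face_v: "face_sum (\<lambda>l. v l b) js = of_int (?A js)"
    if js: "js \<in> tuples I 2" and b: "b \<in> overlap U js" for js b
  proof -
    have bX: "b \<in> topspace X"
      using openin_subset[OF openin_overlap[OF cover js]] b by blast
    have len: "length js = 3"
      using js by (simp add: tuples_def)
    have coeff: "zero_ext U \<phi> t b * face_sum (\<lambda>l. of_int (?A (l @ [t]))) js = zero_ext U \<phi> t b * of_int (?A js)"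
      if t: "t \<in> I" for t
    proof (cases "b \<in> U t")
      case True
      then have jt: "js @ [t] \<in> tuples I (Suc 2)" "overlap U (js @ [t]) \<noteq> {}"
        using js b t by (auto simp: tuples_def overlap_def)
      have "face_sum ?A (js @ [t]) = alt_ext I U (Suc 2) (nerve_coboundary I U 2 \<eta>) (js @ [t])"
        by (rule face_sum_alt_ext[OF jt])
      also have "\<dots> = 0"
        using \<eta> by (simp add: N.cocycles_iff alt_ext_one)
      finally have "face_sum (\<lambda>l. ?A (l @ [t])) js = ?A js"
        by (simp add: face_sum_snoc len)
      then show ?thesis
        by (simp add: face_sum_of_int)
    qed (simp add: zero_ext_def)
    \<comment> \<open>A tuple has finitely many faces, so the alternating sum moves inside the sum
      over \<open>t\<close>. Uniqueness of the sum then compares the result with the constant \<eta>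
      times the total 1 of the partition.\<close>
    have "((\<lambda>t. \<Sum>j<length js. (- 1) ^ j * (zero_ext U \<phi> t b * of_int (?A (omit j js @ [t])))) has_sum
        (\<Sum>j<length js. (- 1) ^ j * v (omit j js) b)) I"
      by (intro has_sum_sum has_sum_cmult_right v_sum[OF bX])
    moreover have "(\<Sum>j<length js. (- 1) ^ j * (zero_ext U \<phi> t b * of_int (?A (omit j js @ [t])))) =
        zero_ext U \<phi> t b * of_int (?A js)" if "t \<in> I" for t
      unfolding coeff[OF that, symmetric] face_sum_def sum_distrib_left by (simp add: mult.left_commute)
    ultimately have "((\<lambda>t. zero_ext U \<phi> t b * of_int (?A js)) has_sum face_sum (\<lambda>l. v l b) js) I"
      unfolding face_sum_def by (simp cong: has_sum_cong)
    moreover have "((\<lambda>t. zero_ext U \<phi> t b * of_int (?A js)) has_sum 1 * of_int (?A js)) I"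
      by (intro has_sum_cmult_left zero_ext_has_sum[OF cover part bX])
    ultimately show ?thesis
      using has_sum_unique by fastforce
  qed
  have omega: "cech_map I U 1 exp_map g = omega I U \<phi> \<eta>"
    by (auto simp: cech_map_def exp_map_def omega_def g_def v_def intro!: restrict_ext)
  have dg: "cech_map I U (Suc 1) incl_Z (nerve_to_cech I U (Suc 1) \<eta>) = cech_coboundary I U (cont_C X) 1 g"
  proof (rule cochain_C_ext[OF cover incl.cech_map_closed[OF cover nerve_to_cech_closed]
        E.dB_closed[OF g]])
    fix js b assume js: "js \<in> tuples I (Suc 1)" and b: "b \<in> overlap U js"
    have "cech_coboundary I U (cont_C X) 1 g js b = face_sum (\<lambda>l. g l b) js"
      by (rule coboundary_cont_C[OF cover g js b])
    also have "\<dots> = face_sum (\<lambda>l. complex_of_real (v l b)) js"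
      using js b overlap_omit[of U js] omit_tuples[OF js]
      by (intro face_sum_cong) (auto simp: g_def tuples_def)
    also have "\<dots> = complex_of_real (face_sum (\<lambda>l. v l b) js)"
      by (simp add: face_sum_def)
    also have "face_sum (\<lambda>l. v l b) js = of_int (?A js)"
      using js b by (intro face_v) (simp_all add: numeral_2_eq_2)
    finally show "cech_map I U (Suc 1) incl_Z (nerve_to_cech I U (Suc 1) \<eta>) js b =
        cech_coboundary I U (cont_C X) 1 g js b"
      using js b by (simp add: cech_map_def incl_Z_def nerve_to_cech_def numeral_2_eq_2)
  qed
  \<comment> \<open>The coboundary of \<open>omega\<close> is the exponential of \<delta>g, which is
    integer valued and therefore exponentiates to 1.\<close>
  have "cech_coboundary I U (Im_exp X) 1 (omega I U \<phi> \<eta>) = \<one>\<^bsub>cech_cochains I U (Im_exp X) (Suc 1)\<^esub>"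
    unfolding omega[symmetric] E.p_d[OF g, symmetric] dg[symmetric] by (rule E.p_i[OF nerve_to_cech_closed])
  then have "omega I U \<phi> \<eta> \<in> cocycles (cech_cochains I U (Im_exp X)) (cech_coboundary I U (Im_exp X)) 1"
    using E.p_closed[OF g] unfolding E.C.cocycles_iff omega by simp
  then show "cech_class I U (Im_exp X) 1 (omega I U \<phi> \<eta>) \<in> carrier (cech_cohomology I U (Im_exp X) 1)"
    by (auto simp: E.C.carrier_cohomology)
  \<comment> \<open>\<open>g\<close> is the lift of \<open>omega\<close>, and
    \<open>nerve_to_cech I U 2 \<eta>\<close> is the integral cochain that its coboundary comes
    from.\<close>
  show "Delta X I U (cech_class I U (Im_exp X) 1 (omega I U \<phi> \<eta>)) =
      cech_class I U (const_Z X) 2 (nerve_to_cech I U 2 \<eta>)"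
    unfolding Delta_eq_connect[OF cover] omega[symmetric]
    using E.connect_eq[OF g nerve_to_cech_closed dg] by (simp add: numeral_2_eq_2)
qed

end

theorem corollary4p8:
  fixes X :: "'a topology" and I :: "'i::linorder set" and U :: "'i \<Rightarrow> 'a set"
    and \<phi> :: "'i \<Rightarrow> 'a \<Rightarrow> real"
  assumes "paracompact_space X" and "Hausdorff_space X"
    and "open_cover X I U"
    and "dominated_partition_of_unity X I U \<phi>"
    and "\<And>r t. r \<in> I \<Longrightarrow> t \<in> I \<Longrightarrow> U r \<inter> U t = {} \<or> connectedin X (U r \<inter> U t)"
  shows "Delta X I U \<in> iso (cech_cohomology I U (Im_exp X) 1) (cech_cohomology I U (const_Z X) 2) \<and>
    Delta_inv X I U \<circ> Psi X I U \<in> mon (nerve_cohomology I U 2) (cech_cohomology I U (Im_exp X) 1) \<and>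
    (\<forall>\<eta> \<in> cocycles (nerve_cochains I U) (nerve_coboundary I U) 2.
       \<eta> \<in> carrier (nerve_cochains_fs I U 2) \<or> locally_finite_partition X I U \<phi> \<longrightarrow>
       (Delta_inv X I U \<circ> Psi X I U) (coho_class (nerve_cochains I U) (nerve_coboundary I U) 2 \<eta>)
         = cech_class I U (Im_exp X) 1 (omega I U \<phi> \<eta>))"
proof (intro conjI ballI impI)
  note cover = assms(3) and part = assms(4)
  show iso: "Delta X I U \<in> iso (cech_cohomology I U (Im_exp X) 1) (cech_cohomology I U (const_Z X) 2)"
    by (rule Delta_iso[OF cover part])
  have "Delta_inv X I U \<in> mon (cech_cohomology I U (const_Z X) 2) (cech_cohomology I U (Im_exp X) 1)"
    using Delta_inv_iso[OF cover part] by (simp add: iso_iff_mon_epi)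
  then show "Delta_inv X I U \<circ> Psi X I U \<in> mon (nerve_cohomology I U 2) (cech_cohomology I U (Im_exp X) 1)"
    using Psi_mon[OF cover assms(5)] by (intro mon_compose)
  fix \<eta> assume \<eta>: "\<eta> \<in> cocycles (nerve_cochains I U) (nerve_coboundary I U) 2"
    and fs: "\<eta> \<in> carrier (nerve_cochains_fs I U 2) \<or> locally_finite_partition X I U \<phi>"
  \<comment> \<open>Finite support makes all but finitely many coefficients zero everywhere; local
    finiteness does the same to the functions, on one neighbourhood of \<open>b\<close>.\<close>
  have fin: "\<exists>F. finite F \<and> F \<subseteq> I \<and>
      eventually (\<lambda>x. \<forall>t\<in>I - F. zero_ext U \<phi> t x * of_int (alt_ext I U 2 \<eta> (l @ [t])) = 0) (nhdsin X b)"
    if b: "b \<in> topspace X" for l b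
    using fs
  proof
    assume "\<eta> \<in> carrier (nerve_cochains_fs I U 2)"
    then have "finite {t \<in> I. alt_ext I U 2 \<eta> (l @ [t]) \<noteq> 0}"
      using finite_support_alt_ext[of \<eta> I U "Suc 0"] by (simp add: numeral_2_eq_2)
    then show ?thesis
      by (intro exI[of _ "{t \<in> I. alt_ext I U 2 \<eta> (l @ [t]) \<noteq> 0}"]) auto
  next
    assume "locally_finite_partition X I U \<phi>"
    then obtain V where V: "openin X V" "b \<in> V" "finite {t \<in> I. \<exists>x\<in>V. zero_ext U \<phi> t x \<noteq> 0}"
      using b by (auto simp: locally_finite_partition_def)
    from eventually_in_openin[OF V(1,2)]
    have "eventually (\<lambda>x. \<forall>t\<in>I - {t \<in> I. \<exists>x\<in>V. zero_ext U \<phi> t x \<noteq> 0}.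
        zero_ext U \<phi> t x * of_int (alt_ext I U 2 \<eta> (l @ [t])) = 0) (nhdsin X b)"
      by eventually_elim auto
    with V(3) show ?thesis by blast
  qed
  have "\<eta> \<in> carrier (nerve_cochains I U 2)"
    using \<eta> by (simp add: cocycles_def kernel_def)
  then have "Psi X I U (coho_class (nerve_cochains I U) (nerve_coboundary I U) 2 \<eta>) =
      Delta X I U (cech_class I U (Im_exp X) 1 (omega I U \<phi> \<eta>))"
    using Delta_omega(2)[OF cover part \<eta> fin] Psi_coho_class[OF cover] by simp
  moreover have "inj_on (Delta X I U) (carrier (cech_cohomology I U (Im_exp X) 1))"
    using iso by (simp add: iso_iff)
  ultimately show "(Delta_inv X I U \<circ> Psi X I U) (coho_class (nerve_cochains I U) (nerve_coboundary I U) 2 \<eta>) =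
      cech_class I U (Im_exp X) 1 (omega I U \<phi> \<eta>)"
    using Delta_omega(1)[OF cover part \<eta> fin] unfolding Delta_inv_def comp_apply
    by (simp only: inv_into_f_f)
qed

end
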